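(* Let $K$ be a field, let $A=K[u,v,w,x,y,z]$ be a polynomial ring, let $f=wv^2x^2-(w+z)vxuy+zu^2y^2\in A$, and let $R=A[t]$ be the polynomial ring in one further variable $t$. Put $J=(t,f)R$, which is generated by a regular sequence of length $2$, and $I=(t,f,x,y)R$. Then the set $\operatorname{Ass}_R H^3_I(J)$ is infinite.
   Context: $H^i_I(M)$ denotes the $i$-th local cohomology module of an $R$-module $M$ with support in the ideal $I$; here $J$ is regarded as an $R$-module. *)

theory Defs
  imports
    "HOL-Algebra.Ideal_Product"
    "HOL-Algebra.Algebraic_Closure_Type"
    "HOL-Library.Poly_Mapping"
    "HOL-Computational_Algebra.Polynomial"
begin

section \<open>Modules over a commutative ring\<close>

definition mod_hom ::
    "('a, 'm) ring_scheme \<Rightarrow> ('a, 'b, 'n) module_scheme \<Rightarrow> ('a, 'c, 'p) module_scheme \<Rightarrow> ('b \<Rightarrow> 'c) set" where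
  "mod_hom R M N =
    {h \<in> carrier M \<rightarrow> carrier N.
      (\<forall>x\<in>carrier M. \<forall>y\<in>carrier M. h (x \<oplus>\<^bsub>M\<^esub> y) = h x \<oplus>\<^bsub>N\<^esub> h y) \<and>
      (\<forall>r\<in>carrier R. \<forall>x\<in>carrier M. h (r \<odot>\<^bsub>M\<^esub> x) = r \<odot>\<^bsub>N\<^esub> h x)}"

text \<open>The record fields \<open>mult\<close> and \<open>one\<close> are part of every module record but play no role
  for modules.\<close>

definition ideal_module :: "('a, 'm) ring_scheme \<Rightarrow> 'a set \<Rightarrow> ('a, 'a) module" where
  "ideal_module R J =
    \<lparr>carrier = J, monoid.mult = monoid.mult R, one = one R, zero = zero R, add = add R,
     module.smult = monoid.mult R\<rparr>"

definition quot_module :: "('a, 'b, 'n) module_scheme \<Rightarrow> 'b set \<Rightarrow> ('a, 'b set) module" where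
  "quot_module M N =
    \<lparr>carrier = a_rcosets\<^bsub>M\<^esub> N, monoid.mult = undefined, one = undefined, zero = N, add = set_add M,
     module.smult = (\<lambda>r C. \<Union>x\<in>C. N +>\<^bsub>M\<^esub> (r \<odot>\<^bsub>M\<^esub> x))\<rparr>"

definition annihilator ::
    "('a, 'm) ring_scheme \<Rightarrow> ('a, 'b, 'n) module_scheme \<Rightarrow> 'b \<Rightarrow> 'a set" where
  "annihilator R M x = {r \<in> carrier R. r \<odot>\<^bsub>M\<^esub> x = \<zero>\<^bsub>M\<^esub>}"

definition Ass :: "('a, 'm) ring_scheme \<Rightarrow> ('a, 'b, 'n) module_scheme \<Rightarrow> 'a set set" where
  "Ass R M = {P. primeideal P R \<and> (\<exists>x\<in>carrier M. P = annihilator R M x)}"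

definition regular_sequence :: "('a, 'm) ring_scheme \<Rightarrow> 'a list \<Rightarrow> bool" where
  "regular_sequence R as \<longleftrightarrow>
    set as \<subseteq> carrier R \<and>
    (\<forall>i<length as. \<forall>r\<in>carrier R.
       as ! i \<otimes>\<^bsub>R\<^esub> r \<in> Idl\<^bsub>R\<^esub> (set (take i as)) \<longrightarrow> r \<in> Idl\<^bsub>R\<^esub> (set (take i as))) \<and>
    Idl\<^bsub>R\<^esub> (set as) \<noteq> carrier R"

section \<open>Injective modules and injective resolutions\<close>

text \<open>HOL cannot quantify over the carrier types of the test modules \<open>N\<close> inside a definition.
  Here they live on the type of the ring. By Baer's criterion this is no restriction: see lemma
  \<open>injective_module_extends\<close> below, where the carrier type of \<open>N\<close> is arbitrary.\<close>

definition injective_module :: "('a, 'm) ring_scheme \<Rightarrow> ('a, 'b, 'n) module_scheme \<Rightarrow> bool" where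
  "injective_module R E \<longleftrightarrow>
    module R E \<and>
    (\<forall>(N :: ('a, 'a) module) H h.
       module R N \<longrightarrow> submodule H R N \<longrightarrow> h \<in> mod_hom R (N\<lparr>carrier := H\<rparr>) E \<longrightarrow>
       (\<exists>g\<in>mod_hom R N E. \<forall>x\<in>H. g x = h x))"

lemma injective_module_extends:
  fixes N :: "('a, 'c, 'p) module_scheme" and E :: "('a, 'b, 'n) module_scheme"
  assumes inj: "injective_module R E" and N: "module R N" and H: "submodule H R N"
    and h: "h \<in> mod_hom R (N\<lparr>carrier := H\<rparr>) E"
  shows "\<exists>g\<in>mod_hom R N E. \<forall>x\<in>H. g x = h x"
proof -
  interpret E: module R E using inj by (simp add: injective_module_def)
  interpret N: module R N by (rule N)
  note HE = N.submoduleE[OF H]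
  have hC: "h x \<in> carrier E" if "x \<in> H" for x using h that by (auto simp: mod_hom_def)
  have hadd: "h (x \<oplus>\<^bsub>N\<^esub> y) = h x \<oplus>\<^bsub>E\<^esub> h y" if "x \<in> H" "y \<in> H" for x y
    using h that by (auto simp: mod_hom_def)
  have hsm: "h (r \<odot>\<^bsub>N\<^esub> x) = r \<odot>\<^bsub>E\<^esub> h x" if "x \<in> H" "r \<in> carrier R" for x r
    using h that by (auto simp: mod_hom_def)
  have H0: "\<zero>\<^bsub>N\<^esub> \<in> H"
    using HE(2,4) N.smult_l_null HE(1) by (metis E.R.zero_closed all_not_in_conv subsetD)
  have h0: "h \<zero>\<^bsub>N\<^esub> = \<zero>\<^bsub>E\<^esub>"
    using hsm[OF H0 E.R.zero_closed] hC[OF H0] by simp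
  define lin where "lin G \<longleftrightarrow>
    (\<forall>x b y c. (x, b) \<in> G \<and> (y, c) \<in> G \<longrightarrow> (x \<oplus>\<^bsub>N\<^esub> y, b \<oplus>\<^bsub>E\<^esub> c) \<in> G) \<and>
    (\<forall>r\<in>carrier R. \<forall>x b. (x, b) \<in> G \<longrightarrow> (r \<odot>\<^bsub>N\<^esub> x, r \<odot>\<^bsub>E\<^esub> b) \<in> G)" for G :: "('c \<times> 'b) set"
  define G0 where "G0 = (\<lambda>x. (x, h x)) ` H"
  define A where "A = {G. G \<subseteq> carrier N \<times> carrier E \<and> G0 \<subseteq> G \<and> lin G \<and>
    (\<forall>b. (\<zero>\<^bsub>N\<^esub>, b) \<in> G \<longrightarrow> b = \<zero>\<^bsub>E\<^esub>)}"
  have linD: "(x \<oplus>\<^bsub>N\<^esub> y, b \<oplus>\<^bsub>E\<^esub> c) \<in> G" "r \<in> carrier R \<Longrightarrow> (r \<odot>\<^bsub>N\<^esub> x, r \<odot>\<^bsub>E\<^esub> b) \<in> G"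
    if "lin G" "(x, b) \<in> G" "(y, c) \<in> G" for G x y b c r
    using that unfolding lin_def by blast+
  have "lin G0"
    unfolding lin_def G0_def using HE hadd hsm by (auto simp: image_iff)
  then have G0A: "G0 \<in> A"
    unfolding A_def using HE(1) hC h0 by (auto simp: G0_def)
  have "\<exists>U\<in>A. \<forall>Q\<in>C. Q \<subseteq> U" if C: "subset.chain A C" for C
  proof (cases "C = {}")
    case True
    then show ?thesis using G0A by blast
  next
    case False
    have CA: "C \<subseteq> A" using C by (simp add: subset.chain_def)
    have tot: "Q \<subseteq> Y \<or> Y \<subseteq> Q" if "Q \<in> C" "Y \<in> C" for Q Y
      using C that by (auto simp: subset_chain_def)
    have "lin (\<Union>C)"
      unfolding lin_def
    proof (intro conjI allI impI ballI)
      fix x b y c assume "(x, b) \<in> \<Union>C \<and> (y, c) \<in> \<Union>C"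
      then obtain Q Y where XY: "Q \<in> C" "Y \<in> C" "(x, b) \<in> Q" "(y, c) \<in> Y" by blast
      then obtain Z where "Z \<in> C" "(x, b) \<in> Z" "(y, c) \<in> Z" using tot by blast
      moreover have "lin Z" using CA \<open>Z \<in> C\<close> by (auto simp: A_def)
      ultimately show "(x \<oplus>\<^bsub>N\<^esub> y, b \<oplus>\<^bsub>E\<^esub> c) \<in> \<Union>C" using linD(1) by blast
    next
      fix r x b assume "r \<in> carrier R" "(x, b) \<in> \<Union>C"
      then obtain Q where "Q \<in> C" "(x, b) \<in> Q" by blast
      moreover have "lin Q" using CA \<open>Q \<in> C\<close> by (auto simp: A_def)
      ultimately show "(r \<odot>\<^bsub>N\<^esub> x, r \<odot>\<^bsub>E\<^esub> b) \<in> \<Union>C"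
        using \<open>r \<in> carrier R\<close> linD(2) by blast
    qed
    moreover have "\<Union>C \<subseteq> carrier N \<times> carrier E"
      using CA unfolding A_def by blast
    moreover have "G0 \<subseteq> \<Union>C"
      using CA False unfolding A_def by blast
    moreover have "\<forall>b. (\<zero>\<^bsub>N\<^esub>, b) \<in> \<Union>C \<longrightarrow> b = \<zero>\<^bsub>E\<^esub>"
      using CA by (auto simp: A_def)
    ultimately have "\<Union>C \<in> A" by (simp add: A_def)
    then show ?thesis by blast
  qed
  then obtain G where GA: "G \<in> A" and Gmax: "\<And>Q. Q \<in> A \<Longrightarrow> G \<subseteq> Q \<Longrightarrow> Q = G"
    using subset_Zorn[of A] by metis
  have GC: "x \<in> carrier N" "b \<in> carrier E" if "(x, b) \<in> G" for x b
    using GA that by (auto simp: A_def)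
  have Glin: "lin G" and G0: "\<And>x. x \<in> H \<Longrightarrow> (x, h x) \<in> G"
    and Gz: "\<And>b. (\<zero>\<^bsub>N\<^esub>, b) \<in> G \<Longrightarrow> b = \<zero>\<^bsub>E\<^esub>"
    using GA by (auto simp: A_def G0_def)
  have Gadd: "(x \<oplus>\<^bsub>N\<^esub> y, b \<oplus>\<^bsub>E\<^esub> c) \<in> G" if "(x, b) \<in> G" "(y, c) \<in> G" for x y b c
    using linD(1)[OF Glin that] .
  have Gsm: "(r \<odot>\<^bsub>N\<^esub> x, r \<odot>\<^bsub>E\<^esub> b) \<in> G" if "(x, b) \<in> G" "r \<in> carrier R" for x b r
    using linD(2)[OF Glin that(1) that(1) that(2)] .
  have Gneg: "(\<ominus>\<^bsub>N\<^esub> x, \<ominus>\<^bsub>E\<^esub> b) \<in> G" if "(x, b) \<in> G" for x b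
    using Gsm[OF that, of "\<ominus>\<^bsub>R\<^esub> \<one>\<^bsub>R\<^esub>"] GC[OF that]
    by (simp add: N.smult_l_minus E.smult_l_minus)
  have Guniq: "b = c" if xb: "(x, b) \<in> G" and xc: "(x, c) \<in> G" for x b c
  proof -
    have "(x \<oplus>\<^bsub>N\<^esub> (\<ominus>\<^bsub>N\<^esub> x), b \<oplus>\<^bsub>E\<^esub> (\<ominus>\<^bsub>E\<^esub> c)) \<in> G" by (rule Gadd[OF xb Gneg[OF xc]])
    then have "b \<oplus>\<^bsub>E\<^esub> (\<ominus>\<^bsub>E\<^esub> c) = \<zero>\<^bsub>E\<^esub>" using Gz GC[OF xb] by (simp add: N.M.r_neg)
    then show ?thesis using GC[OF xb] GC[OF xc]
      by (metis E.M.a_inv_closed E.M.minus_equality E.M.minus_minus)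
  qed
  define k where "k x = (THE b. (x, b) \<in> G)" for x
  have k: "k x = b" if "(x, b) \<in> G" for x b
    unfolding k_def using that Guniq by blast
  have dom: "x \<in> Domain G" if x: "x \<in> carrier N" for x
  proof -
    define L where "L = {r \<in> carrier R. r \<odot>\<^bsub>N\<^esub> x \<in> Domain G}"
    define Rm where "Rm = ideal_module R (carrier R)"
    have Rm: "module R Rm"
    proof (rule moduleI)
      show "cring R" by (rule E.R.cring_axioms)
      show "abelian_group Rm"
      proof (rule abelian_groupI)
        show "\<exists>s\<in>carrier Rm. s \<oplus>\<^bsub>Rm\<^esub> r = \<zero>\<^bsub>Rm\<^esub>" if "r \<in> carrier Rm" for r
          using that by (intro bexI[of _ "\<ominus>\<^bsub>R\<^esub> r"]) (auto simp: Rm_def ideal_module_def E.R.add.l_inv E.R.add.m_comm a_inv_def)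
      qed (auto simp: Rm_def ideal_module_def E.R.add.m_ac)
    qed (auto simp: Rm_def ideal_module_def E.R.l_distr E.R.r_distr E.R.m_assoc)
    interpret Rm: module R Rm by (rule Rm)
    have kin: "(r \<odot>\<^bsub>N\<^esub> x, k (r \<odot>\<^bsub>N\<^esub> x)) \<in> G" if "r \<in> L" for r
      using that k by (auto simp: L_def)
    have Lneg: "a_inv R r \<in> L" if "r \<in> L" for r
      using Gneg[OF kin[OF that]] that x by (auto simp: L_def N.smult_l_minus)
    have Ladd: "r \<oplus>\<^bsub>R\<^esub> s \<in> L \<and> k ((r \<oplus>\<^bsub>R\<^esub> s) \<odot>\<^bsub>N\<^esub> x) = k (r \<odot>\<^bsub>N\<^esub> x) \<oplus>\<^bsub>E\<^esub> k (s \<odot>\<^bsub>N\<^esub> x)"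
      if "r \<in> L" "s \<in> L" for r s
    proof -
      have "((r \<oplus>\<^bsub>R\<^esub> s) \<odot>\<^bsub>N\<^esub> x, k (r \<odot>\<^bsub>N\<^esub> x) \<oplus>\<^bsub>E\<^esub> k (s \<odot>\<^bsub>N\<^esub> x)) \<in> G"
        using Gadd[OF kin[OF that(1)] kin[OF that(2)]] that x
        by (simp add: L_def N.smult_l_distr)
      then show ?thesis using k that by (auto simp: L_def)
    qed
    have Lsm: "r \<otimes>\<^bsub>R\<^esub> s \<in> L \<and> k ((r \<otimes>\<^bsub>R\<^esub> s) \<odot>\<^bsub>N\<^esub> x) = r \<odot>\<^bsub>E\<^esub> k (s \<odot>\<^bsub>N\<^esub> x)"
      if "r \<in> carrier R" "s \<in> L" for r s
    proof -
      have "((r \<otimes>\<^bsub>R\<^esub> s) \<odot>\<^bsub>N\<^esub> x, r \<odot>\<^bsub>E\<^esub> k (s \<odot>\<^bsub>N\<^esub> x)) \<in> G"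
        using Gsm[OF kin[OF that(2)] that(1)] that x by (simp add: L_def N.smult_assoc1)
      then show ?thesis using k that by (auto simp: L_def)
    qed
    have zL: "\<zero>\<^bsub>R\<^esub> \<in> L"
      using G0[OF H0] x by (auto simp: L_def)
    have negRm: "\<ominus>\<^bsub>Rm\<^esub> r = \<ominus>\<^bsub>R\<^esub> r" for r
      by (simp add: a_inv_def m_inv_def Rm_def ideal_module_def)
    have subL: "submodule L R Rm"
    proof (rule Rm.submoduleI)
      show "\<ominus>\<^bsub>Rm\<^esub> a \<in> L" if "a \<in> L" for a using that Lneg negRm by simp
    qed (use zL Ladd Lsm in \<open>auto simp: Rm_def ideal_module_def L_def\<close>)
    have homL: "(\<lambda>r. k (r \<odot>\<^bsub>N\<^esub> x)) \<in> mod_hom R (Rm\<lparr>carrier := L\<rparr>) E"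
      using Ladd Lsm GC(2)[OF kin] by (auto simp: mod_hom_def Rm_def ideal_module_def)
    obtain g where g: "g \<in> mod_hom R Rm E" and gL: "\<And>r. r \<in> L \<Longrightarrow> g r = k (r \<odot>\<^bsub>N\<^esub> x)"
      using inj Rm subL homL unfolding injective_module_def by metis
    define e where "e = g \<one>\<^bsub>R\<^esub>"
    have e: "e \<in> carrier E"
      using g by (auto simp: e_def mod_hom_def Rm_def ideal_module_def)
    have gr: "g r = r \<odot>\<^bsub>E\<^esub> e" if "r \<in> carrier R" for r
    proof -
      have "g (r \<otimes>\<^bsub>R\<^esub> \<one>\<^bsub>R\<^esub>) = r \<odot>\<^bsub>E\<^esub> e"
        using g that E.R.one_closed
        by (simp del: E.R.r_one add: e_def mod_hom_def Rm_def ideal_module_def)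
      then show ?thesis using that by simp
    qed
    define G' where "G' = {(y \<oplus>\<^bsub>N\<^esub> r \<odot>\<^bsub>N\<^esub> x, b \<oplus>\<^bsub>E\<^esub> r \<odot>\<^bsub>E\<^esub> e) | y b r. (y, b) \<in> G \<and> r \<in> carrier R}"
    have G'I: "(z, c) \<in> G'"
      if "(y, b) \<in> G" "r \<in> carrier R" "z = y \<oplus>\<^bsub>N\<^esub> r \<odot>\<^bsub>N\<^esub> x" "c = b \<oplus>\<^bsub>E\<^esub> r \<odot>\<^bsub>E\<^esub> e" for z c y b r
      using that unfolding G'_def by blast
    have sub: "G \<subseteq> G'"
    proof clarify
      fix y b assume yb: "(y, b) \<in> G"
      show "(y, b) \<in> G'" by (rule G'I[OF yb E.R.zero_closed]) (use GC[OF yb] x e in simp_all)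
    qed
    have xG': "(x, e) \<in> G'"
      by (rule G'I[OF G0[OF H0] E.R.one_closed]) (use h0 x e in simp_all)
    have "lin G'"
      unfolding lin_def
    proof (intro conjI allI impI ballI)
      fix y1 b1 y2 b2 assume "(y1, b1) \<in> G' \<and> (y2, b2) \<in> G'"
      then obtain u1 c1 r1 u2 c2 r2 where *: "(u1, c1) \<in> G" "r1 \<in> carrier R" "(u2, c2) \<in> G" "r2 \<in> carrier R"
        "y1 = u1 \<oplus>\<^bsub>N\<^esub> r1 \<odot>\<^bsub>N\<^esub> x" "b1 = c1 \<oplus>\<^bsub>E\<^esub> r1 \<odot>\<^bsub>E\<^esub> e"
        "y2 = u2 \<oplus>\<^bsub>N\<^esub> r2 \<odot>\<^bsub>N\<^esub> x" "b2 = c2 \<oplus>\<^bsub>E\<^esub> r2 \<odot>\<^bsub>E\<^esub> e" unfolding G'_def by blast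
      show "(y1 \<oplus>\<^bsub>N\<^esub> y2, b1 \<oplus>\<^bsub>E\<^esub> b2) \<in> G'"
        by (rule G'I[OF Gadd[OF *(1,3)] E.R.a_closed[OF *(2,4)]])
          (use * GC[OF *(1)] GC[OF *(3)] x e in
            \<open>simp_all add: N.smult_l_distr E.smult_l_distr N.M.a_ac E.M.a_ac\<close>)
    next
      fix r y b assume r: "r \<in> carrier R" and "(y, b) \<in> G'"
      then obtain u c s where *: "(u, c) \<in> G" "s \<in> carrier R"
        "y = u \<oplus>\<^bsub>N\<^esub> s \<odot>\<^bsub>N\<^esub> x" "b = c \<oplus>\<^bsub>E\<^esub> s \<odot>\<^bsub>E\<^esub> e" unfolding G'_def by blast
      show "(r \<odot>\<^bsub>N\<^esub> y, r \<odot>\<^bsub>E\<^esub> b) \<in> G'"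
        by (rule G'I[OF Gsm[OF *(1) r] E.R.m_closed[OF r *(2)]])
          (use * r GC[OF *(1)] x e in
            \<open>simp_all add: N.smult_r_distr E.smult_r_distr N.smult_assoc1 E.smult_assoc1\<close>)
    qed
    moreover have "b = \<zero>\<^bsub>E\<^esub>" if zb: "(\<zero>\<^bsub>N\<^esub>, b) \<in> G'" for b
    proof -
      obtain u c r where *: "(u, c) \<in> G" "r \<in> carrier R"
        "\<zero>\<^bsub>N\<^esub> = u \<oplus>\<^bsub>N\<^esub> r \<odot>\<^bsub>N\<^esub> x" "b = c \<oplus>\<^bsub>E\<^esub> r \<odot>\<^bsub>E\<^esub> e"
        using zb unfolding G'_def by blast
      have "r \<odot>\<^bsub>N\<^esub> x = \<ominus>\<^bsub>N\<^esub> u"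
        using * GC[OF *(1)] x
        by (metis N.M.a_comm N.M.minus_equality N.smult_closed)
      then have rG: "(r \<odot>\<^bsub>N\<^esub> x, \<ominus>\<^bsub>E\<^esub> c) \<in> G" using Gneg[OF *(1)] by simp
      then have "r \<in> L" using * by (auto simp: L_def)
      then have "r \<odot>\<^bsub>E\<^esub> e = \<ominus>\<^bsub>E\<^esub> c" using gL gr[OF *(2)] k[OF rG] by simp
      then show ?thesis using * GC[OF *(1)] by (simp add: E.M.r_neg)
    qed
    moreover have "G' \<subseteq> carrier N \<times> carrier E"
      using GC x e by (auto simp: G'_def)
    moreover have "G0 \<subseteq> G'"
      using sub GA by (auto simp: A_def)
    ultimately have "G' \<in> A" by (simp add: A_def)
    then have "G' = G" using sub Gmax by blast
    then show ?thesis using xG' by blast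
  qed
  have kG: "(x, k x) \<in> G" if "x \<in> carrier N" for x
    using dom[OF that] k by auto
  have "k \<in> mod_hom R N E"
    unfolding mod_hom_def using kG GC(2) k[OF Gadd[OF kG kG]] k[OF Gsm[OF kG]] by auto
  moreover have "\<forall>x\<in>H. k x = h x" using k G0 by blast
  ultimately show ?thesis by blast
qed

definition injective_resolution ::
    "('a, 'm) ring_scheme \<Rightarrow> ('a, 'c, 'n) module_scheme \<Rightarrow> (nat \<Rightarrow> ('a, 'b, 'p) module_scheme) \<Rightarrow>
     (nat \<Rightarrow> 'b \<Rightarrow> 'b) \<Rightarrow> ('c \<Rightarrow> 'b) \<Rightarrow> bool" where
  "injective_resolution R M E d \<epsilon> \<longleftrightarrow>
    module R M \<and> (\<forall>i. injective_module R (E i)) \<and>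
    \<epsilon> \<in> mod_hom R M (E 0) \<and> (\<forall>i. d i \<in> mod_hom R (E i) (E (Suc i))) \<and>
    inj_on \<epsilon> (carrier M) \<and>
    \<epsilon> ` carrier M = a_kernel (E 0) (E 1) (d 0) \<and>
    (\<forall>i. d i ` carrier (E i) = a_kernel (E (Suc i)) (E (Suc (Suc i))) (d (Suc i)))"

section \<open>Local cohomology\<close>

text \<open>The \<open>I\<close>-torsion submodule \<open>\<Gamma>\<^sub>I(M)\<close> of elements annihilated by some power of \<open>I\<close>.\<close>

definition torsion_module ::
    "('a, 'm) ring_scheme \<Rightarrow> 'a set \<Rightarrow> ('a, 'b, 'n) module_scheme \<Rightarrow> ('a, 'b, 'n) module_scheme" where
  "torsion_module R I M =
    M\<lparr>carrier := {x \<in> carrier M. \<exists>n::nat. \<forall>a \<in> I [^]\<^bsub>ideals_set R\<^esub> n. a \<odot>\<^bsub>M\<^esub> x = \<zero>\<^bsub>M\<^esub>}\<rparr>"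

definition cohomology_module ::
    "(nat \<Rightarrow> ('a, 'b, 'p) module_scheme) \<Rightarrow> (nat \<Rightarrow> 'b \<Rightarrow> 'b) \<Rightarrow> nat \<Rightarrow> ('a, 'b set) module" where
  "cohomology_module C d i =
    quot_module
      ((C i)\<lparr>carrier := a_kernel (C i) (C (Suc i)) (d i)\<rparr>)
      (case i of 0 \<Rightarrow> {\<zero>\<^bsub>C 0\<^esub>} | Suc j \<Rightarrow> d j ` carrier (C j))"

text \<open>The \<open>i\<close>-th right derived functor of \<open>\<Gamma>\<^sub>I\<close>, computed from an injective resolution
  \<open>(E, d, \<epsilon>)\<close> of the module in question; up to isomorphism it does not depend on that choice.\<close>

definition local_cohomology ::
    "('a, 'm) ring_scheme \<Rightarrow> 'a set \<Rightarrow> (nat \<Rightarrow> ('a, 'b, 'p) module_scheme) \<Rightarrow> (nat \<Rightarrow> 'b \<Rightarrow> 'b) \<Rightarrow> nat \<Rightarrow>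
     ('a, 'b set) module" where
  "local_cohomology R I E d i = cohomology_module (\<lambda>j. torsion_module R I (E j)) d i"

section \<open>The polynomial rings and the polynomial f\<close>

datatype indet = Ind_u | Ind_v | Ind_w | Ind_x | Ind_y | Ind_z

text \<open>\<open>'k polyA\<close> is \<open>K[u,v,w,x,y,z]\<close>: finitely supported functions from monomials (exponent
  vectors) to coefficients, with the convolution product. \<open>'k polyR\<close> is \<open>A[t]\<close>.\<close>

type_synonym 'k polyA = "(indet \<Rightarrow>\<^sub>0 nat) \<Rightarrow>\<^sub>0 'k"
type_synonym 'k polyR = "'k polyA poly"

definition indet_var :: "indet \<Rightarrow> 'k::field polyA" where
  "indet_var i = Poly_Mapping.single (Poly_Mapping.single i 1) 1"

definition f_poly :: "'k::field polyA" where
  "f_poly =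
    (let u = indet_var Ind_u; v = indet_var Ind_v; w = indet_var Ind_w;
         x = indet_var Ind_x; y = indet_var Ind_y; z = indet_var Ind_z
     in w * v^2 * x^2 - (w + z) * v * x * u * y + z * u^2 * y^2)"

definition ring_R :: "'k::field polyR ring" where
  "ring_R = ring_of_type_algebra"

definition R_t :: "'k::field polyR" where
  "R_t = [:0, 1:]"

text \<open>The images in \<open>R = A[t]\<close> of elements of \<open>A\<close> are the constant polynomials.\<close>

definition R_f :: "'k::field polyR" where "R_f = [:f_poly:]"
definition R_x :: "'k::field polyR" where "R_x = [:indet_var Ind_x:]"
definition R_y :: "'k::field polyR" where "R_y = [:indet_var Ind_y:]"

definition ideal_J :: "'k::field polyR set" where
  "ideal_J = Idl\<^bsub>ring_R\<^esub> {R_t, R_f}"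

definition ideal_I :: "'k::field polyR set" where
  "ideal_I = Idl\<^bsub>ring_R\<^esub> {R_t, R_f, R_x, R_y}"

end

theory Submission
  imports Defs "HOL-Computational_Algebra.Polynomial_Factorial"
begin

text \<open>
  Why the theorem holds. Since \<open>f\<close> lies in \<open>(x, y)\<close>, the ideal \<open>I\<close> equals \<open>(t, x, y)\<close>, and
  \<open>t\<^sup>n, x\<^sup>n, y\<^sup>n\<close> is a regular sequence on \<open>R\<close> for every \<open>n\<close>. Local cohomology in degree 3 is therefore
  top local cohomology of the form \<open>lim J / (t\<^sup>n, x\<^sup>n, y\<^sup>n) J\<close> with multiplication by \<open>txy\<close> as transition map:
  an element \<open>j\<close> of \<open>J\<close> gives a class \<open>[j; n]\<close>, which vanishes iff \<open>(txy)\<^sup>k j\<close> lies in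
  \<open>(t\<^bsup>n+k\<^esup>, x\<^bsup>n+k\<^esup>, y\<^bsup>n+k\<^esup>) J\<close> for some \<open>k\<close>. For an arbitrary injective resolution \<open>E\<close> this is obtained
  by hand: \<open>c\<close> acts surjectively on the elements of an injective module that are killed by an ideal modulo which
  \<open>c\<close> is regular, so a cocycle representing \<open>j\<close> can be divided by \<open>c\<close> and differentiated, which moves it up
  by one degree and makes it killed by \<open>c\<close> (\<open>presents_extend\<close>). Three such steps and a comparison of
  different \<open>n\<close> give \<open>annihilator_of_represented_class\<close>.

  Taking \<open>j = t\<^sup>n g\<close> with \<open>g\<close> in \<open>A\<close>, and comparing coefficients of \<open>t\<^bsup>n+k\<^esup>\<close>, the class \<open>[r j; n]\<close> vanishes
  iff \<open>(xy)\<^sup>k r(0) g\<close> lies in \<open>(f, x\<^bsup>n+k\<^esup>, y\<^bsup>n+k\<^esup>) A\<close> for some \<open>k\<close> (\<open>J_multiples_iff\<close>). This is the embedding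
  of \<open>H\<^sup>2\<close> of \<open>R/J = A/f\<close> with support in \<open>(x, y)\<close> into \<open>H\<^sup>3\<close> of \<open>J\<close>, and the problem becomes Katzman's: the
  hypersurface \<open>A/f\<close> has infinitely many associated primes in this module. Put \<open>X = vx\<close> and \<open>Y = uy\<close>, so that
  \<open>f = (X - Y)(wX - zY)\<close>. Modulo \<open>f\<close> the differences \<open>\<delta>\<^sub>i = X\<^bsup>i+1\<^esup> Y\<^bsup>n-1-i\<^esup> - X\<^sup>i Y\<^bsup>n-i\<^esup>\<close> satisfy
  \<open>w \<delta>\<^bsub>i+1\<^esub> = z \<delta>\<^sub>i\<close>, and their sum is \<open>X\<^sup>n - Y\<^sup>n\<close>. Hence \<open>X Y\<^bsup>n-1\<^esup>\<close> is killed, modulo \<open>x\<^sup>n\<close> and \<open>y\<^sup>n\<close>, by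
  \<open>\<tau> = w\<^bsup>n-1\<^esup> + w\<^bsup>n-2\<^esup> z + \<dots> + z\<^bsup>n-1\<^esup>\<close>, and \<open>z\<^sup>n X Y\<^bsup>n-1\<^esup>\<close> is killed in the limit by \<open>u, v, x, y\<close> as
  well. Conversely a linear functional shows that an element of \<open>K[w, z]\<close> killing it is a multiple of \<open>\<tau>\<close>.
  So if \<open>p\<close> is a prime factor of \<open>1 + T + \<dots> + T\<^bsup>n-1\<^esup>\<close> with homogenization \<open>P(w, z)\<close>, the multiple of the
  class by the cofactor \<open>\<tau> / P\<close> has annihilator exactly the prime ideal \<open>(t, u, v, x, y, P)\<close>
  (\<open>annihilator_in_hypersurface\<close>). For coprime \<open>m\<close> and \<open>n\<close> the polynomials \<open>1 + T + \<dots> + T\<^bsup>m-1\<^esup>\<close> and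
  \<open>1 + T + \<dots> + T\<^bsup>n-1\<^esup>\<close> have no common prime factor, so the prime numbers \<open>n\<close> give infinitely many
  different primes, whatever the characteristic of \<open>K\<close>.
\<close>

section \<open>Injective resolutions and regular sequences\<close>

lemma (in cring) ideal_module_is_module:
  "module R (ideal_module R (carrier R))"
proof (rule moduleI)
  show "abelian_group (ideal_module R (carrier R))"
  proof (rule abelian_groupI)
    show "\<exists>s\<in>carrier (ideal_module R (carrier R)). s \<oplus>\<^bsub>ideal_module R (carrier R)\<^esub> r = \<zero>\<^bsub>ideal_module R (carrier R)\<^esub>"
      if "r \<in> carrier (ideal_module R (carrier R))" for r
      using that by (intro bexI[of _ "\<ominus> r"]) (auto simp: ideal_module_def l_neg)
  qed (auto simp: ideal_module_def a_ac)
qed (auto simp: ideal_module_def l_distr r_distr m_assoc intro: cring_axioms)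

locale resolved_module =
  fixes R :: "('a, 'm) ring_scheme" (structure) and M :: "('a, 'c, 'n) module_scheme"
    and E :: "nat \<Rightarrow> ('a, 'b, 'p) module_scheme" and d :: "nat \<Rightarrow> 'b \<Rightarrow> 'b" and \<epsilon> :: "'c \<Rightarrow> 'b"
  assumes resolution: "injective_resolution R M E d \<epsilon>"
begin

lemma injective_E: "injective_module R (E i)"
  using resolution by (simp add: injective_resolution_def)

sublocale M: module R M
  using resolution by (simp add: injective_resolution_def)

sublocale E: module R "E i" for i
  using injective_E by (simp add: injective_module_def)

lemma
  shows aug_closed [simp]: "j \<in> carrier M \<Longrightarrow> \<epsilon> j \<in> carrier (E 0)"
    and aug_add: "\<lbrakk>j \<in> carrier M; k \<in> carrier M\<rbrakk> \<Longrightarrow> \<epsilon> (j \<oplus>\<^bsub>M\<^esub> k) = \<epsilon> j \<oplus>\<^bsub>E 0\<^esub> \<epsilon> k"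
    and aug_smult: "\<lbrakk>r \<in> carrier R; j \<in> carrier M\<rbrakk> \<Longrightarrow> \<epsilon> (r \<odot>\<^bsub>M\<^esub> j) = r \<odot>\<^bsub>E 0\<^esub> \<epsilon> j"
  using resolution by (auto simp: injective_resolution_def mod_hom_def)

lemma
  shows d_closed [simp]: "e \<in> carrier (E i) \<Longrightarrow> d i e \<in> carrier (E (Suc i))"
    and d_add: "\<lbrakk>e \<in> carrier (E i); e' \<in> carrier (E i)\<rbrakk> \<Longrightarrow> d i (e \<oplus>\<^bsub>E i\<^esub> e') = d i e \<oplus>\<^bsub>E (Suc i)\<^esub> d i e'"
    and d_smult: "\<lbrakk>r \<in> carrier R; e \<in> carrier (E i)\<rbrakk> \<Longrightarrow> d i (r \<odot>\<^bsub>E i\<^esub> e) = r \<odot>\<^bsub>E (Suc i)\<^esub> d i e"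
  using resolution by (auto simp: injective_resolution_def mod_hom_def)

lemma aug_zero: "\<epsilon> \<zero>\<^bsub>M\<^esub> = \<zero>\<^bsub>E 0\<^esub>"
  using aug_smult[of "\<zero>" "\<zero>\<^bsub>M\<^esub>"] by simp

lemma d_zero [simp]: "d i \<zero>\<^bsub>E i\<^esub> = \<zero>\<^bsub>E (Suc i)\<^esub>"
  using d_smult[of "\<zero>" "\<zero>\<^bsub>E i\<^esub>" i] by simp

lemma d_minus: "e \<in> carrier (E i) \<Longrightarrow> d i (\<ominus>\<^bsub>E i\<^esub> e) = \<ominus>\<^bsub>E (Suc i)\<^esub> d i e"
  using d_smult[of "\<ominus> \<one>" e i] by (simp add: E.smult_l_minus)

lemma d_diff: "\<lbrakk>e \<in> carrier (E i); e' \<in> carrier (E i)\<rbrakk> \<Longrightarrow> d i (e \<ominus>\<^bsub>E i\<^esub> e') = d i e \<ominus>\<^bsub>E (Suc i)\<^esub> d i e'"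
  by (simp add: a_minus_def d_add d_minus)

lemma smult_diff: "\<lbrakk>r \<in> carrier R; e \<in> carrier (E i); e' \<in> carrier (E i)\<rbrakk> \<Longrightarrow>
    r \<odot>\<^bsub>E i\<^esub> (e \<ominus>\<^bsub>E i\<^esub> e') = r \<odot>\<^bsub>E i\<^esub> e \<ominus>\<^bsub>E i\<^esub> r \<odot>\<^bsub>E i\<^esub> e'"
  by (simp add: a_minus_def E.smult_r_distr E.smult_r_minus)

lemma diff_self [simp]: "e \<in> carrier (E i) \<Longrightarrow> e \<ominus>\<^bsub>E i\<^esub> e = \<zero>\<^bsub>E i\<^esub>"
  by (simp add: a_minus_def E.M.r_neg)

lemma diff_zero [simp]: "e \<in> carrier (E i) \<Longrightarrow> e \<ominus>\<^bsub>E i\<^esub> \<zero>\<^bsub>E i\<^esub> = e"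
  by (simp add: a_minus_def)

lemma diff_eq_zeroD:
  assumes "e \<in> carrier (E i)" "e' \<in> carrier (E i)" "e \<ominus>\<^bsub>E i\<^esub> e' = \<zero>\<^bsub>E i\<^esub>"
  shows "e = e'"
  using assms unfolding a_minus_def by (metis E.M.a_inv_closed E.M.minus_equality E.M.minus_minus)

lemma smult_comm: "\<lbrakk>r \<in> carrier R; a \<in> carrier R; e \<in> carrier (E i)\<rbrakk> \<Longrightarrow>
    a \<odot>\<^bsub>E i\<^esub> (r \<odot>\<^bsub>E i\<^esub> e) = r \<odot>\<^bsub>E i\<^esub> (a \<odot>\<^bsub>E i\<^esub> e)"
  by (simp add: E.smult_assoc1[symmetric] M.R.m_comm)

lemma aug_inj: "\<lbrakk>j \<in> carrier M; \<epsilon> j = \<zero>\<^bsub>E 0\<^esub>\<rbrakk> \<Longrightarrow> j = \<zero>\<^bsub>M\<^esub>"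
  using resolution aug_zero by (auto simp: injective_resolution_def inj_on_def)

lemma aug_exact: "(\<exists>j\<in>carrier M. e = \<epsilon> j) \<longleftrightarrow> e \<in> carrier (E 0) \<and> d 0 e = \<zero>\<^bsub>E 1\<^esub>"
proof -
  have "\<epsilon> ` carrier M = a_kernel (E 0) (E 1) (d 0)" (is "?L = ?K")
    using resolution by (simp add: injective_resolution_def)
  then have "e \<in> ?L \<longleftrightarrow> e \<in> ?K" by simp
  then show ?thesis by (simp only: image_iff a_kernel_def' mem_Collect_eq)
qed

lemma d_exact: "(\<exists>p\<in>carrier (E i). e = d i p) \<longleftrightarrow> e \<in> carrier (E (Suc i)) \<and> d (Suc i) e = \<zero>\<^bsub>E (Suc (Suc i))\<^esub>"
proof -
  have "d i ` carrier (E i) = a_kernel (E (Suc i)) (E (Suc (Suc i))) (d (Suc i))" (is "?L = ?K")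
    using resolution by (simp add: injective_resolution_def)
  then have "e \<in> ?L \<longleftrightarrow> e \<in> ?K" by simp
  then show ?thesis by (simp only: image_iff a_kernel_def' mem_Collect_eq)
qed

lemma dd: "e \<in> carrier (E i) \<Longrightarrow> d (Suc i) (d i e) = \<zero>\<^bsub>E (Suc (Suc i))\<^esub>"
  using d_exact by blast

lemma d_aug: "j \<in> carrier M \<Longrightarrow> d 0 (\<epsilon> j) = \<zero>\<^bsub>E (Suc 0)\<^esub>"
  using aug_exact by force

text \<open>Under the identification of \<open>Hom(R/(A), E i)\<close> with its image under evaluation at 1, this is that module;
  for varying \<open>i\<close> it gives the complex whose cohomology is \<open>Ext(R/(A), M)\<close>.\<close>

definition killed :: "'a set \<Rightarrow> nat \<Rightarrow> 'b set" where
  "killed A i = {e \<in> carrier (E i). \<forall>a\<in>A. a \<odot>\<^bsub>E i\<^esub> e = \<zero>\<^bsub>E i\<^esub>}"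

lemma killed_carrier: "e \<in> killed A i \<Longrightarrow> e \<in> carrier (E i)"
  by (simp add: killed_def)

lemma killed_Idl:
  assumes "A \<subseteq> carrier R" "e \<in> killed A i" "a \<in> Idl A"
  shows "a \<odot>\<^bsub>E i\<^esub> e = \<zero>\<^bsub>E i\<^esub>"
proof -
  have e: "e \<in> carrier (E i)" using assms by (simp add: killed_def)
  have "ideal {r \<in> carrier R. r \<odot>\<^bsub>E i\<^esub> e = \<zero>\<^bsub>E i\<^esub>} R"
  proof (rule idealI)
    show "subgroup {r \<in> carrier R. r \<odot>\<^bsub>E i\<^esub> e = \<zero>\<^bsub>E i\<^esub>} (add_monoid R)"
      by (rule M.R.add.subgroupI)
        (use e in \<open>auto simp: E.smult_l_distr E.smult_l_minus a_inv_def[symmetric] intro!: exI[of _ "\<zero>"]\<close>)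
  next
    fix a x assume "a \<in> {r \<in> carrier R. r \<odot>\<^bsub>E i\<^esub> e = \<zero>\<^bsub>E i\<^esub>}" "x \<in> carrier R"
    then show "x \<otimes> a \<in> {r \<in> carrier R. r \<odot>\<^bsub>E i\<^esub> e = \<zero>\<^bsub>E i\<^esub>}"
      "a \<otimes> x \<in> {r \<in> carrier R. r \<odot>\<^bsub>E i\<^esub> e = \<zero>\<^bsub>E i\<^esub>}"
      using e smult_comm[of x a] by (auto simp: E.smult_assoc1)
  qed (simp add: M.R.ring_axioms)
  moreover have "A \<subseteq> {r \<in> carrier R. r \<odot>\<^bsub>E i\<^esub> e = \<zero>\<^bsub>E i\<^esub>}"
    using assms by (auto simp: killed_def)
  ultimately show ?thesis using assms(3) M.R.genideal_minimal by blast
qed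

text \<open>The only use of injectivity: \<open>a + c s \<mapsto> s e\<close> is well defined on the ideal generated by \<open>A\<close> and \<open>c\<close>,
  because \<open>c\<close> is regular modulo \<open>A\<close> and \<open>A\<close> kills \<open>e\<close>; the value at 1 of an extension to \<open>R\<close> is the quotient.\<close>

lemma killed_divisible:
  assumes A: "A \<subseteq> carrier R" and c: "c \<in> carrier R"
    and reg: "\<forall>r\<in>carrier R. c \<otimes> r \<in> Idl A \<longrightarrow> r \<in> Idl A"
    and e: "e \<in> killed A i"
  shows "\<exists>e'\<in>killed A i. c \<odot>\<^bsub>E i\<^esub> e' = e"
proof -
  interpret A: ideal "Idl A" R by (rule M.R.genideal_ideal[OF A])
  note [simp] = A.Icarr
  have eC: "e \<in> carrier (E i)" using e by (rule killed_carrier)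
  define N where "N = ideal_module R (carrier R)"
  have N: "module R N" unfolding N_def by (rule M.R.ideal_module_is_module)
  interpret N: module R N by (rule N)
  have Nsimps: "carrier N = carrier R" "a \<oplus>\<^bsub>N\<^esub> b = a \<oplus> b" "a \<odot>\<^bsub>N\<^esub> b = a \<otimes> b" "\<zero>\<^bsub>N\<^esub> = \<zero>" for a b
    by (simp_all add: N_def ideal_module_def)
  have Nneg: "\<ominus>\<^bsub>N\<^esub> r = \<ominus> r" for r
    by (simp add: a_inv_def m_inv_def N_def ideal_module_def)
  define H where "H = {a \<oplus> c \<otimes> s | a s. a \<in> Idl A \<and> s \<in> carrier R}"
  have HI: "r \<in> H" if "a \<in> Idl A" "s \<in> carrier R" "r = a \<oplus> c \<otimes> s" for r a s
    using that by (auto simp: H_def)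
  define g where "g r = (SOME s. s \<in> carrier R \<and> (\<exists>a\<in>Idl A. r = a \<oplus> c \<otimes> s))" for r
  define h where "h r = g r \<odot>\<^bsub>E i\<^esub> e" for r
  have uniq: "s \<odot>\<^bsub>E i\<^esub> e = s' \<odot>\<^bsub>E i\<^esub> e"
    if "a \<in> Idl A" "s \<in> carrier R" "a' \<in> Idl A" "s' \<in> carrier R" and eq: "a \<oplus> c \<otimes> s = a' \<oplus> c \<otimes> s'" for a s a' s'
  proof -
    have ac: "a \<in> carrier R" "a' \<in> carrier R" using that by simp_all
    have "c \<otimes> (s \<ominus> s') = c \<otimes> s \<ominus> c \<otimes> s'"
      using that c by (simp add: a_minus_def M.R.r_distr M.R.r_minus)
    also have "\<dots> = (a \<oplus> c \<otimes> s) \<ominus> (a \<oplus> c \<otimes> s')" using that(2,4) ac c by algebra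
    also have "\<dots> = a' \<ominus> a" unfolding eq using that(2,4) ac c by algebra
    also have "\<dots> \<in> Idl A" using that by (simp add: a_minus_def)
    finally have "c \<otimes> (s \<ominus> s') \<in> Idl A" .
    then have "s \<ominus> s' \<in> Idl A" using reg that(2,4) M.R.minus_closed by blast
    then have "(s \<ominus> s') \<odot>\<^bsub>E i\<^esub> e = \<zero>\<^bsub>E i\<^esub>" using killed_Idl[OF A e] by blast
    moreover have "(s \<ominus> s') \<odot>\<^bsub>E i\<^esub> e = s \<odot>\<^bsub>E i\<^esub> e \<ominus>\<^bsub>E i\<^esub> s' \<odot>\<^bsub>E i\<^esub> e"
      using that eC by (simp add: a_minus_def E.smult_l_distr E.smult_l_minus)
    ultimately show ?thesis using that(2,4) eC by (metis diff_eq_zeroD E.smult_closed)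
  qed
  have h: "h (a \<oplus> c \<otimes> s) = s \<odot>\<^bsub>E i\<^esub> e" if "a \<in> Idl A" "s \<in> carrier R" for a s
  proof -
    have "g (a \<oplus> c \<otimes> s) \<in> carrier R \<and> (\<exists>a'\<in>Idl A. a \<oplus> c \<otimes> s = a' \<oplus> c \<otimes> g (a \<oplus> c \<otimes> s))"
      unfolding g_def by (rule someI[of _ s]) (use that in blast)
    then obtain a' where "g (a \<oplus> c \<otimes> s) \<in> carrier R" "a' \<in> Idl A"
      "a \<oplus> c \<otimes> s = a' \<oplus> c \<otimes> g (a \<oplus> c \<otimes> s)" by blast
    then show ?thesis unfolding h_def using that by (intro uniq[symmetric])
  qed
  have sub: "submodule H R N"
  proof (rule N.submoduleI)
    show "H \<subseteq> carrier N" using c by (auto simp: H_def Nsimps)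
    show "\<zero>\<^bsub>N\<^esub> \<in> H" by (rule HI[of "\<zero>" "\<zero>"]) (use c in \<open>auto simp: Nsimps\<close>)
  next
    fix r assume "r \<in> H"
    then obtain a s where "a \<in> Idl A" "s \<in> carrier R" "r = a \<oplus> c \<otimes> s" by (auto simp: H_def)
    then show "\<ominus>\<^bsub>N\<^esub> r \<in> H"
      using c by (intro HI[of "\<ominus> a" "\<ominus> s"]) (auto simp: Nneg M.R.minus_add M.R.r_minus)
  next
    fix r r' assume "r \<in> H" "r' \<in> H"
    then obtain a s a' s' where *: "a \<in> Idl A" "s \<in> carrier R" "r = a \<oplus> c \<otimes> s"
      "a' \<in> Idl A" "s' \<in> carrier R" "r' = a' \<oplus> c \<otimes> s'" by (auto simp: H_def)
    show "r \<oplus>\<^bsub>N\<^esub> r' \<in> H"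
    proof (rule HI[of "a \<oplus> a'" "s \<oplus> s'"])
      have "a \<in> carrier R" "a' \<in> carrier R" using * by simp_all
      then show "r \<oplus>\<^bsub>N\<^esub> r' = a \<oplus> a' \<oplus> c \<otimes> (s \<oplus> s')" using *(2,3,5,6) c unfolding Nsimps by algebra
    qed (use * in auto)
  next
    fix b r assume b: "b \<in> carrier R" "r \<in> H"
    then obtain a s where *: "a \<in> Idl A" "s \<in> carrier R" "r = a \<oplus> c \<otimes> s" by (auto simp: H_def)
    show "b \<odot>\<^bsub>N\<^esub> r \<in> H"
    proof (rule HI[of "b \<otimes> a" "b \<otimes> s"])
      have "a \<in> carrier R" using * by simp
      then show "b \<odot>\<^bsub>N\<^esub> r = b \<otimes> a \<oplus> c \<otimes> (b \<otimes> s)" using * b c unfolding Nsimps by algebra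
    qed (use * b A.I_l_closed in auto)
  qed
  have hom: "h \<in> mod_hom R (N\<lparr>carrier := H\<rparr>) (E i)"
    unfolding mod_hom_def
  proof (simp add: Nsimps, intro conjI ballI)
    show "h \<in> H \<rightarrow> carrier (E i)" using h eC by (auto simp: H_def)
  next
    fix r r' assume "r \<in> H" "r' \<in> H"
    then obtain a s a' s' where *: "a \<in> Idl A" "s \<in> carrier R" "r = a \<oplus> c \<otimes> s"
      "a' \<in> Idl A" "s' \<in> carrier R" "r' = a' \<oplus> c \<otimes> s'" by (auto simp: H_def)
    have "a \<in> carrier R" "a' \<in> carrier R" using * by simp_all
    then have "r \<oplus> r' = a \<oplus> a' \<oplus> c \<otimes> (s \<oplus> s')" using *(2,3,5,6) c unfolding Nsimps by algebra
    then show "h (r \<oplus> r') = h r \<oplus>\<^bsub>E i\<^esub> h r'"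
      using * h h[of "a \<oplus> a'" "s \<oplus> s'"] eC by (simp add: E.smult_l_distr)
  next
    fix b r assume b: "b \<in> carrier R" "r \<in> H"
    then obtain a s where *: "a \<in> Idl A" "s \<in> carrier R" "r = a \<oplus> c \<otimes> s" by (auto simp: H_def)
    have "a \<in> carrier R" using * by simp
    then have "b \<otimes> r = b \<otimes> a \<oplus> c \<otimes> (b \<otimes> s)" using * b c by algebra
    then show "h (b \<otimes> r) = b \<odot>\<^bsub>E i\<^esub> h r"
      using * b h h[of "b \<otimes> a" "b \<otimes> s"] eC A.I_l_closed by (simp add: E.smult_assoc1)
  qed
  obtain g where g: "g \<in> mod_hom R N (E i)" and gh: "\<And>r. r \<in> H \<Longrightarrow> g r = h r"
    using injective_module_extends[OF injective_E N sub hom] by blast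
  have gs: "r \<odot>\<^bsub>E i\<^esub> g \<one> = g r" if "r \<in> carrier R" for r
  proof -
    have "g (r \<otimes> \<one>) = r \<odot>\<^bsub>E i\<^esub> g \<one>" using g that M.R.one_closed unfolding mod_hom_def Nsimps by blast
    then show ?thesis using that by simp
  qed
  show ?thesis
  proof
    have "a \<odot>\<^bsub>E i\<^esub> g \<one> = \<zero>\<^bsub>E i\<^esub>" if "a \<in> A" for a
    proof -
      have a: "a \<in> Idl A" using that M.R.genideal_self[OF A] by blast
      have aH: "a \<in> H" by (rule HI[OF a M.R.zero_closed]) (use a c in simp)
      have "a \<odot>\<^bsub>E i\<^esub> g \<one> = h a" using gs gh[OF aH] a by simp
      also have "\<dots> = \<zero>\<^bsub>E i\<^esub>" using h[OF a M.R.zero_closed] a c eC by simp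
      finally show ?thesis .
    qed
    then have one: "g \<one> \<in> killed A i" using g by (auto simp: killed_def mod_hom_def Nsimps)
    have cH: "c \<in> H" by (rule HI[of "\<zero>" "\<one>"]) (use c in simp_all)
    have "c \<odot>\<^bsub>E i\<^esub> g \<one> = h c" using gs gh[OF cH] c by simp
    then show "c \<odot>\<^bsub>E i\<^esub> g \<one> = e"
      using h[of "\<zero>" "\<one>"] c eC by simp
    show "g \<one> \<in> killed A i" by (rule one)
  qed
qed

lemma killed_zero: "A \<subseteq> carrier R \<Longrightarrow> \<zero>\<^bsub>E i\<^esub> \<in> killed A i"
  by (auto simp: killed_def)

lemma killed_add: "\<lbrakk>A \<subseteq> carrier R; e \<in> killed A i; e' \<in> killed A i\<rbrakk> \<Longrightarrow> e \<oplus>\<^bsub>E i\<^esub> e' \<in> killed A i"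
  by (auto simp: killed_def E.smult_r_distr subset_eq)

lemma killed_diff: "\<lbrakk>A \<subseteq> carrier R; e \<in> killed A i; e' \<in> killed A i\<rbrakk> \<Longrightarrow> e \<ominus>\<^bsub>E i\<^esub> e' \<in> killed A i"
  by (auto simp: killed_def smult_diff subset_eq)

lemma killed_smult: "\<lbrakk>A \<subseteq> carrier R; r \<in> carrier R; e \<in> killed A i\<rbrakk> \<Longrightarrow> r \<odot>\<^bsub>E i\<^esub> e \<in> killed A i"
  by (auto simp: killed_def smult_comm[of r] subset_eq)

lemma d_killed: "\<lbrakk>A \<subseteq> carrier R; e \<in> killed A i\<rbrakk> \<Longrightarrow> d i e \<in> killed A (Suc i)"
  by (auto simp: killed_def d_smult[symmetric] subset_eq)

lemma killed_insert: "e \<in> killed (insert c A) i \<longleftrightarrow> e \<in> killed A i \<and> c \<odot>\<^bsub>E i\<^esub> e = \<zero>\<^bsub>E i\<^esub>"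
  by (auto simp: killed_def)

definition cocycles :: "'a set \<Rightarrow> nat \<Rightarrow> 'b set" where
  "cocycles A i = {e \<in> killed A i. d i e = \<zero>\<^bsub>E (Suc i)\<^esub>}"

definition boundaries :: "'a set \<Rightarrow> nat \<Rightarrow> 'b set" where
  "boundaries A i = (case i of 0 \<Rightarrow> {\<zero>\<^bsub>E 0\<^esub>} | Suc k \<Rightarrow> d k ` killed A k)"

text \<open>The relation \<open>\<rho>\<close> is the graph, at the level of cocycles, of an isomorphism of \<open>M/Q\<close> with the \<open>s\<close>-th cohomology
  of the complex of elements killed by \<open>A\<close>, and that complex is exact above degree \<open>s\<close>. A relation is used
  because cocycles are determined by \<open>j\<close> only up to boundaries.\<close>

definition presents :: "('c \<times> 'b) set \<Rightarrow> 'c set \<Rightarrow> 'a set \<Rightarrow> nat \<Rightarrow> bool" where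
  "presents \<rho> Q A s \<longleftrightarrow>
    \<rho> \<subseteq> carrier M \<times> cocycles A s \<and>
    (\<forall>j\<in>carrier M. \<exists>e. (j, e) \<in> \<rho>) \<and>
    (\<forall>e\<in>cocycles A s. \<exists>j. (j, e) \<in> \<rho>) \<and>
    (\<forall>j e j' e'. (j, e) \<in> \<rho> \<longrightarrow> (j', e') \<in> \<rho> \<longrightarrow> (j \<ominus>\<^bsub>M\<^esub> j', e \<ominus>\<^bsub>E s\<^esub> e') \<in> \<rho>) \<and>
    (\<forall>r\<in>carrier R. \<forall>j e. (j, e) \<in> \<rho> \<longrightarrow> (r \<odot>\<^bsub>M\<^esub> j, r \<odot>\<^bsub>E s\<^esub> e) \<in> \<rho>) \<and>
    (\<forall>j e. (j, e) \<in> \<rho> \<longrightarrow> e \<in> boundaries A s \<longleftrightarrow> j \<in> Q) \<and>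
    (\<forall>i>s. cocycles A i \<subseteq> boundaries A i)"

lemma presentsD:
  assumes "presents \<rho> Q A s"
  shows "\<rho> \<subseteq> carrier M \<times> cocycles A s"
    and "(\<forall>j\<in>carrier M. \<exists>e. (j, e) \<in> \<rho>)"
    and "(\<forall>e\<in>cocycles A s. \<exists>j. (j, e) \<in> \<rho>)"
    and "(\<forall>j e j' e'. (j, e) \<in> \<rho> \<longrightarrow> (j', e') \<in> \<rho> \<longrightarrow> (j \<ominus>\<^bsub>M\<^esub> j', e \<ominus>\<^bsub>E s\<^esub> e') \<in> \<rho>)"
    and "(\<forall>r\<in>carrier R. \<forall>j e. (j, e) \<in> \<rho> \<longrightarrow> (r \<odot>\<^bsub>M\<^esub> j, r \<odot>\<^bsub>E s\<^esub> e) \<in> \<rho>)"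
    and "(\<forall>j e. (j, e) \<in> \<rho> \<longrightarrow> e \<in> boundaries A s \<longleftrightarrow> j \<in> Q)"
    and "(\<forall>i>s. cocycles A i \<subseteq> boundaries A i)"
  by (insert assms, unfold presents_def, (elim conjE, assumption)+)

lemma presentsI:
  assumes "\<And>j e. (j, e) \<in> \<rho> \<Longrightarrow> j \<in> carrier M \<and> e \<in> cocycles A s"
    and "\<And>j. j \<in> carrier M \<Longrightarrow> \<exists>e. (j, e) \<in> \<rho>"
    and "\<And>e. e \<in> cocycles A s \<Longrightarrow> \<exists>j. (j, e) \<in> \<rho>"
    and "\<And>j e j' e'. \<lbrakk>(j, e) \<in> \<rho>; (j', e') \<in> \<rho>\<rbrakk> \<Longrightarrow> (j \<ominus>\<^bsub>M\<^esub> j', e \<ominus>\<^bsub>E s\<^esub> e') \<in> \<rho>"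
    and "\<And>r j e. \<lbrakk>r \<in> carrier R; (j, e) \<in> \<rho>\<rbrakk> \<Longrightarrow> (r \<odot>\<^bsub>M\<^esub> j, r \<odot>\<^bsub>E s\<^esub> e) \<in> \<rho>"
    and "\<And>j e. (j, e) \<in> \<rho> \<Longrightarrow> e \<in> boundaries A s \<longleftrightarrow> j \<in> Q"
    and "\<And>i. i > s \<Longrightarrow> cocycles A i \<subseteq> boundaries A i"
  shows "presents \<rho> Q A s"
proof -
  have "\<rho> \<subseteq> carrier M \<times> cocycles A s" using assms(1) by auto
  then show ?thesis
    unfolding presents_def
    by (intro conjI allI impI ballI) (assumption | rule assms, assumption+)+
qed

lemma presents_augmentation: "presents {(j, \<epsilon> j) |j. j \<in> carrier M} {\<zero>\<^bsub>M\<^esub>} {} 0"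
proof -
  have diff: "\<epsilon> (j \<ominus>\<^bsub>M\<^esub> k) = \<epsilon> j \<ominus>\<^bsub>E 0\<^esub> \<epsilon> k" if "j \<in> carrier M" "k \<in> carrier M" for j k
    using that aug_smult[of "\<ominus> \<one>" k]
    by (simp add: a_minus_def aug_add M.smult_l_minus E.smult_l_minus)
  have "\<exists>j. e = \<epsilon> j \<and> j \<in> carrier M" if "e \<in> cocycles {} 0" for e
    using that aug_exact[of e] by (auto simp: cocycles_def killed_def)
  moreover have "\<epsilon> j \<in> boundaries {} 0 \<longleftrightarrow> j \<in> {\<zero>\<^bsub>M\<^esub>}" if "j \<in> carrier M" for j
    using that aug_inj aug_zero by (auto simp: boundaries_def)
  moreover have "cocycles {} i \<subseteq> boundaries {} i" if "i > 0" for i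
  proof -
    obtain k where i: "i = Suc k" using \<open>i > 0\<close> by (cases i) simp_all
    show ?thesis
    proof
      fix e assume "e \<in> cocycles {} i"
      then have "e \<in> carrier (E (Suc k)) \<and> d (Suc k) e = \<zero>\<^bsub>E (Suc (Suc k))\<^esub>"
        by (simp add: cocycles_def killed_def i)
      then obtain p where "p \<in> carrier (E k)" "e = d k p" unfolding d_exact[symmetric] by blast
      then show "e \<in> boundaries {} i" unfolding boundaries_def killed_def i by simp
    qed
  qed
  ultimately show ?thesis
    unfolding presents_def
    by (auto simp: diff aug_smult cocycles_def killed_def d_aug)
qed

text \<open>The long exact sequence of \<open>0 \<rightarrow> C\<^sub>c \<rightarrow> C \<rightarrow> C \<rightarrow> 0\<close>, where \<open>C\<close> is the complex of elements killed by \<open>A\<close>,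
  the second map is multiplication by \<open>c\<close> (surjective by \<open>killed_divisible\<close>) and \<open>C\<^sub>c\<close> is its kernel. As
  \<open>C\<close> has cohomology \<open>M/Q\<close> in degree \<open>s\<close> and none above, \<open>C\<^sub>c\<close> has cohomology \<open>M/(Q + cM)\<close> in degree
  \<open>s + 1\<close> and none above; the new relation is the connecting homomorphism: divide by \<open>c\<close>, then differentiate.\<close>

lemma presents_extend:
  assumes P: "presents \<rho> Q A s"
    and A: "A \<subseteq> carrier R" and c: "c \<in> carrier R"
    and reg: "\<forall>r\<in>carrier R. c \<otimes> r \<in> Idl A \<longrightarrow> r \<in> Idl A"
  shows "presents {(j, d s e) |j e. e \<in> killed A s \<and> (j, c \<odot>\<^bsub>E s\<^esub> e) \<in> \<rho>}
    {q \<oplus>\<^bsub>M\<^esub> c \<odot>\<^bsub>M\<^esub> j |q j. q \<in> Q \<inter> carrier M \<and> j \<in> carrier M} (insert c A) (Suc s)"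
    (is "presents ?\<rho> ?Q ?B _")
proof -
  note div = killed_divisible[OF A c reg]
  note kC = killed_carrier
  have B: "?B \<subseteq> carrier R" using A c by simp
  have dom: "j \<in> carrier M" "e \<in> cocycles A s" if "(j, e) \<in> \<rho>" for j e
    using presentsD(1)[OF P] that by auto
  have tot: "\<exists>e. (j, e) \<in> \<rho>" if "j \<in> carrier M" for j using presentsD(2)[OF P] that by blast
  have onto: "\<exists>j. (j, e) \<in> \<rho>" if "e \<in> cocycles A s" for e using presentsD(3)[OF P] that by blast
  have diff: "(j \<ominus>\<^bsub>M\<^esub> j', e \<ominus>\<^bsub>E s\<^esub> e') \<in> \<rho>" if "(j, e) \<in> \<rho>" "(j', e') \<in> \<rho>" for j e j' e'
    using presentsD(4)[OF P] that by blast
  have smul: "(r \<odot>\<^bsub>M\<^esub> j, r \<odot>\<^bsub>E s\<^esub> e) \<in> \<rho>" if "(j, e) \<in> \<rho>" "r \<in> carrier R" for r j e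
    using presentsD(5)[OF P] that by blast
  have bd: "e \<in> boundaries A s \<longleftrightarrow> j \<in> Q" if "(j, e) \<in> \<rho>" for j e
    using presentsD(6)[OF P] that by blast
  have van: "cocycles A i \<subseteq> boundaries A i" if "i > s" for i
    using presentsD(7)[OF P] that by blast
  have cocD: "e \<in> killed A i" "d i e = \<zero>\<^bsub>E (Suc i)\<^esub>" if "e \<in> cocycles A i" for e i
    using that by (auto simp: cocycles_def)
  have coc: "d i p \<in> cocycles ?B (Suc i)"
    if "p \<in> killed A i" "c \<odot>\<^bsub>E i\<^esub> p \<in> cocycles A i" for i p
    using that c d_killed[OF A that(1)] kC[OF that(1)]
    by (simp add: cocycles_def killed_insert dd d_smult[symmetric])
  have lift: "\<exists>p. p \<in> killed A i \<and> k = d i p \<and> c \<odot>\<^bsub>E i\<^esub> p \<in> cocycles A i"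
    if k: "k \<in> cocycles ?B (Suc i)" and i: "s \<le> i" for i k
  proof -
    have "k \<in> cocycles A (Suc i)" using k by (auto simp: cocycles_def killed_insert)
    then have "k \<in> boundaries A (Suc i)" using van[of "Suc i"] i by auto
    then obtain p where p: "p \<in> killed A i" "k = d i p" by (auto simp: boundaries_def)
    have "c \<odot>\<^bsub>E i\<^esub> p \<in> cocycles A i"
      using k p c kC[OF p(1)] killed_smult[OF A c p(1)]
      by (simp add: cocycles_def killed_insert d_smult)
    then show ?thesis using p by blast
  qed
  \<comment> \<open>If \<open>c p\<close> is a boundary of something divisible by \<open>c\<close>, subtracting that boundary from \<open>p\<close> makes it killed by \<open>c\<close>.\<close>
  have absorb: "\<exists>h\<in>killed ?B i. d i h = d i p"
    if p: "p \<in> killed A i" and cp: "c \<odot>\<^bsub>E i\<^esub> p \<in> boundaries A i" for i p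
  proof (cases i)
    case 0
    then show ?thesis using p cp by (auto simp: boundaries_def killed_insert)
  next
    case (Suc l)
    then obtain q where q: "q \<in> killed A l" "c \<odot>\<^bsub>E i\<^esub> p = d l q" using cp by (auto simp: boundaries_def)
    obtain q' where q': "q' \<in> killed A l" "c \<odot>\<^bsub>E l\<^esub> q' = q" using div[OF q(1)] by blast
    have pc: "p \<in> carrier (E (Suc l))" using kC[OF p] Suc by simp
    have qc: "q' \<in> carrier (E l)" using kC[OF q'(1)] .
    have "p \<ominus>\<^bsub>E (Suc l)\<^esub> d l q' \<in> killed A (Suc l)"
      by (rule killed_diff[OF A]) (use p Suc d_killed[OF A q'(1)] in simp_all)
    moreover have "c \<odot>\<^bsub>E (Suc l)\<^esub> (p \<ominus>\<^bsub>E (Suc l)\<^esub> d l q') = \<zero>\<^bsub>E (Suc l)\<^esub>"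
      using pc qc c q(2) Suc q'(2) kC[OF q(1)] by (simp add: smult_diff d_smult[symmetric])
    moreover have "d (Suc l) (p \<ominus>\<^bsub>E (Suc l)\<^esub> d l q') = d (Suc l) p"
      using pc qc by (simp add: d_diff dd)
    ultimately have "p \<ominus>\<^bsub>E (Suc l)\<^esub> d l q' \<in> killed ?B i" "d i (p \<ominus>\<^bsub>E (Suc l)\<^esub> d l q') = d i p"
      using Suc by (simp_all add: killed_insert)
    then show ?thesis by blast
  qed
  show ?thesis
  proof (rule presentsI)
    show "j \<in> carrier M \<and> e \<in> cocycles ?B (Suc s)" if "(j, e) \<in> ?\<rho>" for j e
      using that dom coc by blast
    show "\<exists>e. (j, e) \<in> ?\<rho>" if "j \<in> carrier M" for j
    proof -
      obtain e where e: "(j, e) \<in> \<rho>" using tot \<open>j \<in> carrier M\<close> by blast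
      obtain e' where "e' \<in> killed A s" "c \<odot>\<^bsub>E s\<^esub> e' = e" using div[OF cocD(1)[OF dom(2)[OF e]]] by blast
      then show "\<exists>e. (j, e) \<in> ?\<rho>" using e by blast
    qed
    show "\<exists>j. (j, e) \<in> ?\<rho>" if "e \<in> cocycles ?B (Suc s)" for e
      using lift[OF that] onto by blast
    show "(j \<ominus>\<^bsub>M\<^esub> j', e \<ominus>\<^bsub>E (Suc s)\<^esub> e') \<in> ?\<rho>" if je: "(j, e) \<in> ?\<rho>" "(j', e') \<in> ?\<rho>" for j e j' e'
    proof -
      obtain p p' where p: "e = d s p" "p \<in> killed A s" "(j, c \<odot>\<^bsub>E s\<^esub> p) \<in> \<rho>"
        "e' = d s p'" "p' \<in> killed A s" "(j', c \<odot>\<^bsub>E s\<^esub> p') \<in> \<rho>" using je by auto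
      have "e \<ominus>\<^bsub>E (Suc s)\<^esub> e' = d s (p \<ominus>\<^bsub>E s\<^esub> p')" using p kC by (simp add: d_diff)
      moreover have "(j \<ominus>\<^bsub>M\<^esub> j', c \<odot>\<^bsub>E s\<^esub> (p \<ominus>\<^bsub>E s\<^esub> p')) \<in> \<rho>"
        using diff[OF p(3,6)] p(2,5) c kC by (simp add: smult_diff)
      ultimately show ?thesis using killed_diff[OF A p(2,5)] by blast
    qed
    show "(r \<odot>\<^bsub>M\<^esub> j, r \<odot>\<^bsub>E (Suc s)\<^esub> e) \<in> ?\<rho>" if je: "(j, e) \<in> ?\<rho>" and r: "r \<in> carrier R" for r j e
    proof -
      obtain p where p: "e = d s p" "p \<in> killed A s" "(j, c \<odot>\<^bsub>E s\<^esub> p) \<in> \<rho>" using je by auto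
      have "r \<odot>\<^bsub>E (Suc s)\<^esub> e = d s (r \<odot>\<^bsub>E s\<^esub> p)" using p kC r by (simp add: d_smult)
      moreover have "(r \<odot>\<^bsub>M\<^esub> j, c \<odot>\<^bsub>E s\<^esub> (r \<odot>\<^bsub>E s\<^esub> p)) \<in> \<rho>"
        using smul[OF p(3) r] c r kC[OF p(2)] by (simp add: smult_comm)
      ultimately show ?thesis using killed_smult[OF A r p(2)] by blast
    qed
    show "e \<in> boundaries ?B (Suc s) \<longleftrightarrow> j \<in> ?Q" if je: "(j, e) \<in> ?\<rho>" for j e
    proof -
      obtain p where p: "e = d s p" "p \<in> killed A s" "(j, c \<odot>\<^bsub>E s\<^esub> p) \<in> \<rho>" using je by auto
      note jM = dom(1)[OF p(3)] and pc = kC[OF p(2)]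
      show ?thesis
      proof
        assume "e \<in> boundaries ?B (Suc s)"
        then obtain h where h: "h \<in> killed ?B s" "e = d s h" by (auto simp: boundaries_def)
        then have hA: "h \<in> killed A s" "c \<odot>\<^bsub>E s\<^esub> h = \<zero>\<^bsub>E s\<^esub>" by (simp_all add: killed_insert)
        note hc = kC[OF hA(1)]
        have "p \<ominus>\<^bsub>E s\<^esub> h \<in> cocycles A s"
          using killed_diff[OF A p(2) hA(1)] h(2) p(1) pc hc by (simp add: cocycles_def d_diff)
        then obtain k where k: "(k, p \<ominus>\<^bsub>E s\<^esub> h) \<in> \<rho>" using onto by blast
        note kM = dom(1)[OF k]
        have "c \<odot>\<^bsub>E s\<^esub> (p \<ominus>\<^bsub>E s\<^esub> h) = c \<odot>\<^bsub>E s\<^esub> p"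
          using pc hc c hA(2) by (simp add: smult_diff)
        then have "(j \<ominus>\<^bsub>M\<^esub> c \<odot>\<^bsub>M\<^esub> k, \<zero>\<^bsub>E s\<^esub>) \<in> \<rho>"
          using diff[OF p(3) smul[OF k c]] pc c by simp
        moreover have "\<zero>\<^bsub>E s\<^esub> \<in> boundaries A s"
        proof (cases s)
          case (Suc l)
          show ?thesis unfolding boundaries_def Suc using killed_zero[OF A] by (auto intro!: image_eqI[of _ _ "\<zero>\<^bsub>E l\<^esub>"])
        qed (simp add: boundaries_def)
        ultimately have "j \<ominus>\<^bsub>M\<^esub> c \<odot>\<^bsub>M\<^esub> k \<in> Q" using bd by blast
        moreover have "j = (j \<ominus>\<^bsub>M\<^esub> c \<odot>\<^bsub>M\<^esub> k) \<oplus>\<^bsub>M\<^esub> c \<odot>\<^bsub>M\<^esub> k"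
          using jM kM c by (simp add: a_minus_def M.M.a_assoc M.M.l_neg)
        ultimately show "j \<in> ?Q" using jM kM c by blast
      next
        assume "j \<in> ?Q"
        then obtain q k where q: "j = q \<oplus>\<^bsub>M\<^esub> c \<odot>\<^bsub>M\<^esub> k" "q \<in> Q" "q \<in> carrier M" "k \<in> carrier M" by auto
        obtain e' where e': "(k, e') \<in> \<rho>" using tot q by blast
        note e'k = cocD[OF dom(2)[OF e']]
        note e'c = kC[OF e'k(1)]
        have "(j \<ominus>\<^bsub>M\<^esub> c \<odot>\<^bsub>M\<^esub> k, c \<odot>\<^bsub>E s\<^esub> (p \<ominus>\<^bsub>E s\<^esub> e')) \<in> \<rho>"
          using diff[OF p(3) smul[OF e' c]] pc e'c c by (simp add: smult_diff)
        moreover have "j \<ominus>\<^bsub>M\<^esub> c \<odot>\<^bsub>M\<^esub> k = q"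
          unfolding q(1) using q(3,4) c by (simp add: a_minus_def M.M.a_assoc M.M.r_neg)
        ultimately have "c \<odot>\<^bsub>E s\<^esub> (p \<ominus>\<^bsub>E s\<^esub> e') \<in> boundaries A s" using bd q(2) by simp
        then obtain h where "h \<in> killed ?B s" "d s h = d s (p \<ominus>\<^bsub>E s\<^esub> e')"
          using absorb[OF killed_diff[OF A p(2) e'k(1)]] by blast
        moreover have "d s (p \<ominus>\<^bsub>E s\<^esub> e') = e"
          using p(1) pc e'c e'k(2) by (simp add: d_diff)
        ultimately show "e \<in> boundaries ?B (Suc s)" by (auto simp: boundaries_def)
      qed
    qed
    show "cocycles ?B i \<subseteq> boundaries ?B i" if i: "i > Suc s" for i
    proof
      fix k assume k: "k \<in> cocycles ?B i"
      obtain l where l: "i = Suc l" "l > s" using i by (metis Suc_lessE)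
      obtain p where p: "p \<in> killed A l" "k = d l p" "c \<odot>\<^bsub>E l\<^esub> p \<in> cocycles A l"
        using lift[of k l] k l by auto
      then obtain h where "h \<in> killed ?B l" "d l h = d l p" using absorb[OF p(1)] van[OF l(2)] by blast
      then have "k \<in> d l ` killed ?B l" unfolding p(2) by (metis imageI)
      then show "k \<in> boundaries ?B i" by (simp add: boundaries_def l(1))
    qed
  qed
qed

text \<open>Lists hold the regular sequence with its last member in front, so that each recursion step adjoins one member
  and raises the cohomological degree, which is the length of the list, by one.\<close>

primrec represents :: "'a list \<Rightarrow> ('c \<times> 'b) set" where
  "represents [] = {(j, \<epsilon> j) |j. j \<in> carrier M}"
| "represents (c # as) = {(j, d (length as) e) |j e.
    e \<in> killed (set as) (length as) \<and> (j, c \<odot>\<^bsub>E (length as)\<^esub> e) \<in> represents as}"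

primrec multiples :: "'a list \<Rightarrow> 'c set" where
  "multiples [] = {\<zero>\<^bsub>M\<^esub>}"
| "multiples (c # as) = {q \<oplus>\<^bsub>M\<^esub> c \<odot>\<^bsub>M\<^esub> j |q j. q \<in> multiples as \<and> j \<in> carrier M}"

primrec regular_rev :: "'a list \<Rightarrow> bool" where
  "regular_rev [] \<longleftrightarrow> True"
| "regular_rev (c # as) \<longleftrightarrow> regular_rev as \<and>
    (\<forall>r\<in>carrier R. c \<otimes> r \<in> Idl (set as) \<longrightarrow> r \<in> Idl (set as))"

lemma multiples_subset: "set as \<subseteq> carrier R \<Longrightarrow> multiples as \<subseteq> carrier M"
  by (induction as) auto

lemma presents_represents:
  assumes "regular_rev as" "set as \<subseteq> carrier R"
  shows "presents (represents as) (multiples as) (set as) (length as)"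
  using assms
proof (induction as)
  case Nil
  then show ?case using presents_augmentation by simp
next
  case (Cons c as)
  have eq: "multiples as \<inter> carrier M = multiples as" using multiples_subset[of as] Cons.prems by auto
  have IH: "presents (represents as) (multiples as) (set as) (length as)" using Cons by simp
  have "presents (represents (c # as)) (multiples (c # as)) (insert c (set as)) (Suc (length as))"
    unfolding represents.simps multiples.simps
    by (rule presents_extend[OF IH, unfolded eq]) (use Cons.prems in auto)
  then show ?case by simp
qed

lemma represents_smult:
  assumes "set as \<subseteq> carrier R" "(j, e) \<in> represents as" "r \<in> carrier R"
  shows "(r \<odot>\<^bsub>M\<^esub> j, r \<odot>\<^bsub>E (length as)\<^esub> e) \<in> represents as"
  using assms
proof (induction as arbitrary: e)
  case Nil
  then show ?case by (auto simp: aug_smult)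
next
  case (Cons c as)
  then obtain p where p: "e = d (length as) p" "p \<in> killed (set as) (length as)"
    "(j, c \<odot>\<^bsub>E (length as)\<^esub> p) \<in> represents as" by auto
  have pc: "p \<in> carrier (E (length as))" using p(2) by (rule killed_carrier)
  have c: "c \<in> carrier R" and as: "set as \<subseteq> carrier R" using Cons.prems by auto
  have "(r \<odot>\<^bsub>M\<^esub> j, c \<odot>\<^bsub>E (length as)\<^esub> (r \<odot>\<^bsub>E (length as)\<^esub> p)) \<in> represents as"
    using Cons.IH[OF as p(3) Cons.prems(3)] smult_comm[OF Cons.prems(3) c pc] by simp
  moreover have "r \<odot>\<^bsub>E (length as)\<^esub> p \<in> killed (set as) (length as)"
    using killed_smult[OF as Cons.prems(3) p(2)] .
  moreover have "d (length as) (r \<odot>\<^bsub>E (length as)\<^esub> p) = r \<odot>\<^bsub>E (length (c # as))\<^esub> e"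
    using d_smult[OF Cons.prems(3) pc] p(1) by simp
  ultimately show ?case by (metis (mono_tags, lifting) mem_Collect_eq represents.simps(2))
qed

text \<open>The same chain of cocycles that represents \<open>j\<close> for the sequence \<open>g a\<close> represents \<open>(\<Prod>a. f a) j\<close> for the sequence
  \<open>f a g a\<close>. With powers for \<open>f\<close> and \<open>g\<close> this is the transition map of the direct system.\<close>

lemma represents_rescale:
  assumes "set as \<subseteq> carrier R" "g \<in> carrier R \<rightarrow> carrier R" "h \<in> carrier R \<rightarrow> carrier R"
    and "\<And>a. a \<in> set as \<Longrightarrow> h a = f a \<otimes> g a"
    and "f \<in> carrier R \<rightarrow> carrier R" "(j, e) \<in> represents (map g as)"
  shows "(foldr (\<lambda>a r. f a \<otimes> r) as \<one> \<odot>\<^bsub>M\<^esub> j, e) \<in> represents (map h as)"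
  using assms
proof (induction as arbitrary: e)
  case Nil
  then show ?case by auto
next
  case (Cons c as)
  define F where "F = foldr (\<lambda>a r. f a \<otimes> r) as \<one>"
  have as: "set as \<subseteq> carrier R" and c: "c \<in> carrier R" using Cons.prems by auto
  have F: "F \<in> carrier R"
    using as Cons.prems(5) unfolding F_def by (induction as) auto
  have fc: "f c \<in> carrier R" "g c \<in> carrier R" using c Cons.prems by auto
  obtain p where p: "e = d (length as) p" "p \<in> killed (set (map g as)) (length as)"
    "(j, g c \<odot>\<^bsub>E (length as)\<^esub> p) \<in> represents (map g as)" using Cons.prems by auto
  have pc: "p \<in> carrier (E (length as))" using p(2) by (rule killed_carrier)
  have jM: "j \<in> carrier M" if "(j, e) \<in> represents as" for j e as
    using that by (induction as arbitrary: e) auto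
  have "(F \<odot>\<^bsub>M\<^esub> j, g c \<odot>\<^bsub>E (length as)\<^esub> p) \<in> represents (map h as)"
    using Cons.IH[OF as Cons.prems(2,3) _ Cons.prems(5) p(3)] Cons.prems(4) by (simp add: F_def)
  then have "(f c \<odot>\<^bsub>M\<^esub> (F \<odot>\<^bsub>M\<^esub> j), f c \<odot>\<^bsub>E (length as)\<^esub> (g c \<odot>\<^bsub>E (length as)\<^esub> p)) \<in> represents (map h as)"
    using represents_smult[of "map h as" _ _ "f c"] as Cons.prems(3) fc by (auto simp: image_subset_iff)
  then have "((f c \<otimes> F) \<odot>\<^bsub>M\<^esub> j, h c \<odot>\<^bsub>E (length as)\<^esub> p) \<in> represents (map h as)"
    using Cons.prems(4)[of c] fc F pc jM[OF p(3)] by (simp add: M.smult_assoc1 E.smult_assoc1)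
  moreover have "p \<in> killed (set (map h as)) (length as)"
    unfolding killed_def
  proof (intro CollectI conjI ballI)
    fix b assume "b \<in> set (map h as)"
    then obtain a where a: "a \<in> set as" "b = h a" by auto
    have "f a \<in> carrier R" "g a \<in> carrier R" using a as Cons.prems by auto
    moreover have "g a \<odot>\<^bsub>E (length as)\<^esub> p = \<zero>\<^bsub>E (length as)\<^esub>" using p(2) a by (auto simp: killed_def)
    ultimately show "b \<odot>\<^bsub>E (length as)\<^esub> p = \<zero>\<^bsub>E (length as)\<^esub>"
      using Cons.prems(4)[of a] a pc by (simp add: E.smult_assoc1)
  qed (rule pc)
  ultimately show ?case unfolding F_def p(1) by auto
qed

end

section \<open>Annihilators of classes in local cohomology\<close>

text \<open>The left-hand side is the scalar multiple of the coset \<open>N + x\<close> in the quotient module.\<close>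

lemma (in module) coset_smult_eq_zero_iff:
  assumes N: "N \<subseteq> carrier M" "\<zero>\<^bsub>M\<^esub> \<in> N"
    and add: "\<And>x y. \<lbrakk>x \<in> N; y \<in> N\<rbrakk> \<Longrightarrow> x \<oplus>\<^bsub>M\<^esub> y \<in> N"
    and smult: "\<And>r x. \<lbrakk>r \<in> carrier R; x \<in> N\<rbrakk> \<Longrightarrow> r \<odot>\<^bsub>M\<^esub> x \<in> N"
    and x: "x \<in> carrier M" and r: "r \<in> carrier R"
  shows "(\<Union>y\<in>N +>\<^bsub>M\<^esub> x. N +>\<^bsub>M\<^esub> (r \<odot>\<^bsub>M\<^esub> y)) = N \<longleftrightarrow> r \<odot>\<^bsub>M\<^esub> x \<in> N"
    (is "?C = N \<longleftrightarrow> _")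
proof
  have zx: "\<zero>\<^bsub>M\<^esub> \<oplus>\<^bsub>M\<^esub> x \<in> N +>\<^bsub>M\<^esub> x" using N by (auto simp: a_r_coset_def')
  have "\<zero>\<^bsub>M\<^esub> \<oplus>\<^bsub>M\<^esub> r \<odot>\<^bsub>M\<^esub> (\<zero>\<^bsub>M\<^esub> \<oplus>\<^bsub>M\<^esub> x) \<in> ?C"
    using N zx by (auto simp: a_r_coset_def')
  then show "r \<odot>\<^bsub>M\<^esub> x \<in> N" if "?C = N" using that x r by simp
  assume rx: "r \<odot>\<^bsub>M\<^esub> x \<in> N"
  show "?C = N"
  proof
    show "?C \<subseteq> N"
    proof
      fix z assume "z \<in> ?C"
      then obtain n n' where n: "n \<in> N" "n' \<in> N" "z = n \<oplus>\<^bsub>M\<^esub> r \<odot>\<^bsub>M\<^esub> (n' \<oplus>\<^bsub>M\<^esub> x)" by (auto simp: a_r_coset_def')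
      then have "z = n \<oplus>\<^bsub>M\<^esub> (r \<odot>\<^bsub>M\<^esub> n' \<oplus>\<^bsub>M\<^esub> r \<odot>\<^bsub>M\<^esub> x)" using N x r by (auto simp: smult_r_distr subset_iff)
      then show "z \<in> N" using n add smult rx r by simp
    qed
    show "N \<subseteq> ?C"
    proof
      fix z assume z: "z \<in> N"
      have zM: "z \<in> carrier M" using N z by auto
      have "\<ominus>\<^bsub>M\<^esub> (r \<odot>\<^bsub>M\<^esub> x) = (\<ominus> \<one>) \<odot>\<^bsub>M\<^esub> (r \<odot>\<^bsub>M\<^esub> x)" using x r by (simp add: smult_l_minus)
      then have "z \<oplus>\<^bsub>M\<^esub> \<ominus>\<^bsub>M\<^esub> (r \<odot>\<^bsub>M\<^esub> x) \<in> N" using add smult rx z by simp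
      moreover have "z = z \<oplus>\<^bsub>M\<^esub> \<ominus>\<^bsub>M\<^esub> (r \<odot>\<^bsub>M\<^esub> x) \<oplus>\<^bsub>M\<^esub> r \<odot>\<^bsub>M\<^esub> (\<zero>\<^bsub>M\<^esub> \<oplus>\<^bsub>M\<^esub> x)"
        using zM x r by (simp add: M.a_assoc M.l_neg)
      ultimately have "z \<in> N +>\<^bsub>M\<^esub> (r \<odot>\<^bsub>M\<^esub> (\<zero>\<^bsub>M\<^esub> \<oplus>\<^bsub>M\<^esub> x))" by (auto simp: a_r_coset_def')
      then show "z \<in> ?C" using zx by blast
    qed
  qed
qed

text \<open>If \<open>a\<^bsup>f a\<^esup>\<close> kills \<open>x\<close> for all \<open>a\<close> in \<open>S\<close>, then each \<open>a x\<close> satisfies the same with a smaller exponent at \<open>a\<close>,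
  so induction on the sum of the exponents shows that a power of the ideal kills \<open>x\<close>.\<close>

lemma (in cring) torsion_iff_killed_by_powers:
  assumes M: "module R M" and S: "finite S" "S \<subseteq> carrier R" and x: "x \<in> carrier M"
  shows "(\<exists>n::nat. \<forall>a \<in> (Idl S) [^]\<^bsub>ideals_set R\<^esub> n. a \<odot>\<^bsub>M\<^esub> x = \<zero>\<^bsub>M\<^esub>) \<longleftrightarrow>
    (\<exists>n::nat. \<forall>a\<in>S. (a [^] n) \<odot>\<^bsub>M\<^esub> x = \<zero>\<^bsub>M\<^esub>)"
proof -
  interpret M: module R M by (rule M)
  have I: "ideal (Idl S) R" by (rule genideal_ideal[OF S(2)])
  have pow: "(Idl S) [^]\<^bsub>ideals_set R\<^esub> (Suc n) = ideal_prod R ((Idl S) [^]\<^bsub>ideals_set R\<^esub> n) (Idl S)" for n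
    by (simp add: nat_pow_def ideals_set_def)
  have pow0: "(Idl S) [^]\<^bsub>ideals_set R\<^esub> (0::nat) = carrier R"
    by (simp add: nat_pow_def ideals_set_def)
  have powI: "ideal ((Idl S) [^]\<^bsub>ideals_set R\<^esub> (n::nat)) R" for n
  proof (induction n)
    case 0
    then show ?case by (simp only: pow0 oneideal)
  next
    case (Suc n)
    then show ?case using ideal_prod_is_ideal[OF Suc I] by (simp only: pow)
  qed
  have "a [^] n \<in> (Idl S) [^]\<^bsub>ideals_set R\<^esub> n" if "a \<in> S" for a and n :: nat
  proof (induction n)
    case 0
    then show ?case by (simp only: pow0 nat_pow_0 one_closed)
  next
    case (Suc n)
    have "a \<in> Idl S" using that genideal_self[OF S(2)] by blast
    with Suc show ?case unfolding pow nat_pow_Suc by (rule ideal_prod.prod)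
  qed
  moreover have "\<forall>i \<in> (Idl S) [^]\<^bsub>ideals_set R\<^esub> (Suc (sum f S)). i \<odot>\<^bsub>M\<^esub> x = \<zero>\<^bsub>M\<^esub>"
    if "x \<in> carrier M" "\<forall>a\<in>S. (a [^] f a) \<odot>\<^bsub>M\<^esub> x = \<zero>\<^bsub>M\<^esub>" for f :: "_ \<Rightarrow> nat" and x
    using that
  proof (induction "sum f S" arbitrary: f x rule: less_induct)
    case less
    note x = less.prems(1)
    let ?P = "(Idl S) [^]\<^bsub>ideals_set R\<^esub> (sum f S)"
    interpret P: ideal ?P R by (rule powI)
    define L where "L = {s \<in> carrier R. \<forall>i\<in>?P. i \<odot>\<^bsub>M\<^esub> (s \<odot>\<^bsub>M\<^esub> x) = \<zero>\<^bsub>M\<^esub>}"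
    have "ideal L R"
    proof (rule idealI)
      show "subgroup L (add_monoid R)"
        by (rule add.subgroupI)
          (use x P.Icarr in \<open>auto simp: L_def M.smult_l_distr M.smult_l_minus M.smult_r_distr M.smult_r_minus
             a_inv_def[symmetric] intro!: exI[of _ "\<zero>"]\<close>)
    next
      fix a s assume a: "a \<in> L" and s: "s \<in> carrier R"
      have *: "i \<odot>\<^bsub>M\<^esub> ((s \<otimes> a) \<odot>\<^bsub>M\<^esub> x) = \<zero>\<^bsub>M\<^esub>" if i: "i \<in> ?P" for i
      proof -
        have "i \<odot>\<^bsub>M\<^esub> ((s \<otimes> a) \<odot>\<^bsub>M\<^esub> x) = (i \<otimes> s) \<odot>\<^bsub>M\<^esub> (a \<odot>\<^bsub>M\<^esub> x)"
          using a s x P.Icarr[OF i] by (simp add: L_def M.smult_assoc1)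
        then show ?thesis using a P.I_r_closed[OF i s] by (simp add: L_def)
      qed
      then show "s \<otimes> a \<in> L" using a s by (simp add: L_def)
      then show "a \<otimes> s \<in> L" using a s by (simp add: L_def m_comm)
    qed (rule ring_axioms)
    moreover have "S \<subseteq> L"
    proof
      fix a assume a: "a \<in> S"
      then have aR: "a \<in> carrier R" using S by auto
      have "i \<odot>\<^bsub>M\<^esub> (a \<odot>\<^bsub>M\<^esub> x) = \<zero>\<^bsub>M\<^esub>" if i: "i \<in> ?P" for i
      proof (cases "f a")
        case 0
        then have "x = \<zero>\<^bsub>M\<^esub>" using less.prems a by force
        then show ?thesis using P.Icarr[OF i] aR by simp
      next
        case (Suc m)
        define g where "g = f(a := m)"
        have "sum f S = f a + sum f (S - {a})" using S(1) a by (rule sum.remove)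
        moreover have "sum g S = g a + sum g (S - {a})" using S(1) a by (rule sum.remove)
        moreover have "sum g (S - {a}) = sum f (S - {a})" by (rule sum.cong) (auto simp: g_def)
        ultimately have fg: "sum f S = Suc (sum g S)" using Suc by (simp add: g_def)
        have "(b [^] g b) \<odot>\<^bsub>M\<^esub> (a \<odot>\<^bsub>M\<^esub> x) = \<zero>\<^bsub>M\<^esub>" if b: "b \<in> S" for b
        proof (cases "b = a")
          case True
          have "(a [^] f a) \<odot>\<^bsub>M\<^esub> x = \<zero>\<^bsub>M\<^esub>" using less.prems a by blast
          then show ?thesis using True Suc aR x by (simp add: g_def M.smult_assoc1)
        next
          case False
          have bR: "b [^] f b \<in> carrier R" using b S by auto
          have "(b [^] f b) \<odot>\<^bsub>M\<^esub> (a \<odot>\<^bsub>M\<^esub> x) = a \<odot>\<^bsub>M\<^esub> ((b [^] f b) \<odot>\<^bsub>M\<^esub> x)"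
            using bR aR x by (simp add: M.smult_assoc1[symmetric] m_comm)
          then show ?thesis using False less.prems b aR by (simp add: g_def)
        qed
        then show ?thesis using less.hyps[of g "a \<odot>\<^bsub>M\<^esub> x"] fg i aR x by simp
      qed
      then show "a \<in> L" using aR by (simp add: L_def)
    qed
    ultimately have IL: "Idl S \<subseteq> L" by (rule genideal_minimal)
    show ?case
    proof
      fix i assume "i \<in> (Idl S) [^]\<^bsub>ideals_set R\<^esub> (Suc (sum f S))"
      then have "i \<in> ideal_prod R ?P (Idl S)" by (simp only: pow)
      then have "i \<in> carrier R \<and> i \<odot>\<^bsub>M\<^esub> x = \<zero>\<^bsub>M\<^esub>"
      proof induction
        case (prod i s)
        then have "s \<in> L" using IL by blast
        then show ?case using prod x P.Icarr[OF prod(1)] by (simp add: L_def M.smult_assoc1)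
      next
        case (sum s1 s2)
        then show ?case using x by (simp add: M.smult_l_distr)
      qed
      then show "i \<odot>\<^bsub>M\<^esub> x = \<zero>\<^bsub>M\<^esub>" ..
    qed
  qed
  ultimately show ?thesis using x by meson
qed

context resolved_module
begin

lemma killed_powers_mono:
  assumes "S \<subseteq> carrier R" "e \<in> killed ((\<lambda>a. a [^] (n::nat)) ` S) i"
  shows "e \<in> killed ((\<lambda>a. a [^] (k + n)) ` S) i"
proof -
  have e: "e \<in> carrier (E i)" using assms(2) by (rule killed_carrier)
  have "(a [^] (k + n)) \<odot>\<^bsub>E i\<^esub> e = \<zero>\<^bsub>E i\<^esub>" if a: "a \<in> S" for a
  proof -
    have aR: "a \<in> carrier R" using a assms(1) by blast
    have "(a [^] (k + n)) \<odot>\<^bsub>E i\<^esub> e = (a [^] k) \<odot>\<^bsub>E i\<^esub> ((a [^] n) \<odot>\<^bsub>E i\<^esub> e)"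
      using aR e by (simp add: M.R.nat_pow_mult[symmetric] E.smult_assoc1)
    then show ?thesis using assms(2) a aR by (simp add: killed_def)
  qed
  then show ?thesis using e by (auto simp: killed_def)
qed

lemma torsion_carrier:
  assumes "finite S" "S \<subseteq> carrier R"
  shows "carrier (torsion_module R (Idl S) (E i)) = (\<Union>n::nat. killed ((\<lambda>a. a [^] n) ` S) i)"
proof -
  have "e \<in> carrier (torsion_module R (Idl S) (E i)) \<longleftrightarrow> e \<in> (\<Union>n::nat. killed ((\<lambda>a. a [^] n) ` S) i)" for e
  proof (cases "e \<in> carrier (E i)")
    case True
    then show ?thesis
      using M.R.torsion_iff_killed_by_powers[OF E.module_axioms assms True]
      by (simp add: torsion_module_def killed_def)
  next
    case False
    then show ?thesis by (simp add: torsion_module_def killed_def)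
  qed
  then show ?thesis by blast
qed

lemma carrier_local_cohomology_Suc:
  "carrier (local_cohomology R I E d (Suc s)) =
    (\<lambda>e. d s ` carrier (torsion_module R I (E s)) +>\<^bsub>E (Suc s)\<^esub> e) `
      {e \<in> carrier (torsion_module R I (E (Suc s))). d (Suc s) e = \<zero>\<^bsub>E (Suc (Suc s))\<^esub>}"
  by (auto simp: local_cohomology_def cohomology_module_def quot_module_def A_RCOSETS_def'
      a_r_coset_def' a_kernel_def' torsion_module_def)

lemma annihilator_local_cohomology_Suc:
  "annihilator R (local_cohomology R I E d (Suc s)) C =
    {r \<in> carrier R. (\<Union>y\<in>C. d s ` carrier (torsion_module R I (E s)) +>\<^bsub>E (Suc s)\<^esub> (r \<odot>\<^bsub>E (Suc s)\<^esub> y)) =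
       d s ` carrier (torsion_module R I (E s))}"
  by (simp add: annihilator_def local_cohomology_def cohomology_module_def quot_module_def
      a_r_coset_def' torsion_module_def)

text \<open>Local cohomology as the direct limit of the modules \<open>M / (a\<^sub>1\<^sup>m, \<dots>, a\<^sub>s\<^sup>m) M\<close>: the class represented by \<open>r j\<close> is
  zero iff it bounds an element killed by the powers \<open>a\<^bsup>k+n\<^esup>\<close> for some \<open>k\<close>, because the torsion submodule is
  the union of the submodules killed by powers.\<close>

theorem annihilator_of_represented_class:
  fixes n :: nat
  assumes rs: "set rs \<subseteq> carrier R" and len: "length rs = Suc s"
    and reg: "\<And>m::nat. regular_rev (map (\<lambda>a. a [^] m) rs)"
    and j: "j \<in> carrier M"
  shows "\<exists>C\<in>carrier (local_cohomology R (Idl (set rs)) E d (length rs)).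
    annihilator R (local_cohomology R (Idl (set rs)) E d (length rs)) C =
      {r \<in> carrier R. \<exists>k::nat. foldr (\<lambda>a b. a [^] k \<otimes> b) rs \<one> \<odot>\<^bsub>M\<^esub> (r \<odot>\<^bsub>M\<^esub> j) \<in>
         multiples (map (\<lambda>a. a [^] (k + n)) rs)}"
proof -
  define K where "K m = killed ((\<lambda>a. a [^] m) ` set rs)" for m :: nat
  define \<Gamma> where "\<Gamma> i = (\<Union>m. K m i)" for i
  define N where "N = d s ` \<Gamma> s"
  have \<Gamma>: "carrier (torsion_module R (Idl (set rs)) (E i)) = \<Gamma> i" for i
    unfolding \<Gamma>_def K_def using rs by (simp add: torsion_carrier)
  have pow: "(\<lambda>a. a [^] m) ` set rs \<subseteq> carrier R" for m :: nat using rs by auto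
  have mono: "e \<in> K (k + m) i" if "e \<in> K m i" for e k m i
    using that unfolding K_def by (rule killed_powers_mono[OF rs])
  have pres: "presents (represents (map (\<lambda>a. a [^] m) rs)) (multiples (map (\<lambda>a. a [^] m) rs))
      ((\<lambda>a. a [^] m) ` set rs) (Suc s)" for m :: nat
    using presents_represents[OF reg, of m] pow by (simp add: len)
  have bd: "e \<in> d s ` K m s \<longleftrightarrow> i \<in> multiples (map (\<lambda>a. a [^] m) rs)"
    if "(i, e) \<in> represents (map (\<lambda>a. a [^] m) rs)" for i e and m :: nat
    using presentsD(6)[OF pres, of m] that by (simp add: boundaries_def K_def)
  obtain e where e: "(j, e) \<in> represents (map (\<lambda>a. a [^] n) rs)"
    using presentsD(2)[OF pres] j by blast
  then have "e \<in> cocycles ((\<lambda>a. a [^] n) ` set rs) (Suc s)"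
    using presentsD(1)[OF pres] by blast
  then have eK: "e \<in> K n (Suc s)" and de: "d (Suc s) e = \<zero>\<^bsub>E (Suc (Suc s))\<^esub>"
    by (auto simp: cocycles_def K_def)
  have eC: "e \<in> carrier (E (Suc s))" using eK by (auto simp: K_def killed_def)
  have \<Gamma>C: "\<Gamma> i \<subseteq> carrier (E i)" for i by (auto simp: \<Gamma>_def K_def killed_def)
  have NC: "N \<subseteq> carrier (E (Suc s))" using subsetD[OF \<Gamma>C] by (auto simp: N_def)
  have N0: "\<zero>\<^bsub>E (Suc s)\<^esub> \<in> N"
    unfolding N_def by (rule image_eqI[of _ _ "\<zero>\<^bsub>E s\<^esub>"]) (use killed_zero[OF pow] in \<open>auto simp: \<Gamma>_def K_def\<close>)
  have Nadd: "x \<oplus>\<^bsub>E (Suc s)\<^esub> y \<in> N" if "x \<in> N" "y \<in> N" for x y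
  proof -
    obtain g h m m' where g: "x = d s g" "g \<in> K m s" and h: "y = d s h" "h \<in> K m' s"
      using \<open>x \<in> N\<close> \<open>y \<in> N\<close> by (auto simp: N_def \<Gamma>_def)
    have "g \<in> K (m' + m) s" "h \<in> K (m' + m) s"
      using mono[OF g(2), of m'] mono[OF h(2), of m] by (simp_all add: add.commute)
    then have "g \<oplus>\<^bsub>E s\<^esub> h \<in> \<Gamma> s" unfolding \<Gamma>_def K_def using killed_add[OF pow] by blast
    moreover have "x \<oplus>\<^bsub>E (Suc s)\<^esub> y = d s (g \<oplus>\<^bsub>E s\<^esub> h)"
      using g h by (simp add: d_add K_def killed_carrier)
    ultimately show ?thesis by (auto simp: N_def)
  qed
  have Nsm: "r \<odot>\<^bsub>E (Suc s)\<^esub> x \<in> N" if r: "r \<in> carrier R" and "x \<in> N" for r x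
  proof -
    obtain g m where g: "x = d s g" "g \<in> K m s" using \<open>x \<in> N\<close> by (auto simp: N_def \<Gamma>_def)
    have "r \<odot>\<^bsub>E s\<^esub> g \<in> \<Gamma> s" using g(2) unfolding \<Gamma>_def K_def using killed_smult[OF pow r] by blast
    moreover have "r \<odot>\<^bsub>E (Suc s)\<^esub> x = d s (r \<odot>\<^bsub>E s\<^esub> g)"
      using g r by (simp add: d_smult K_def killed_carrier)
    ultimately show ?thesis by (auto simp: N_def)
  qed
  have key: "r \<odot>\<^bsub>E (Suc s)\<^esub> e \<in> N \<longleftrightarrow> (\<exists>k::nat. foldr (\<lambda>a b. a [^] k \<otimes> b) rs \<one> \<odot>\<^bsub>M\<^esub> (r \<odot>\<^bsub>M\<^esub> j) \<in>
         multiples (map (\<lambda>a. a [^] (k + n)) rs))" (is "_ \<longleftrightarrow> (\<exists>k. ?m k)") if r: "r \<in> carrier R" for r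
  proof -
    have "(r \<odot>\<^bsub>M\<^esub> j, r \<odot>\<^bsub>E (Suc s)\<^esub> e) \<in> represents (map (\<lambda>a. a [^] n) rs)"
      using represents_smult[OF _ e r] pow by (simp add: len)
    then have "(foldr (\<lambda>a b. a [^] k \<otimes> b) rs \<one> \<odot>\<^bsub>M\<^esub> (r \<odot>\<^bsub>M\<^esub> j), r \<odot>\<^bsub>E (Suc s)\<^esub> e) \<in> represents (map (\<lambda>a. a [^] (k + n)) rs)"
      for k :: nat
      by (rule represents_rescale[OF rs, rotated -1]) (use rs in \<open>auto simp: M.R.nat_pow_mult subset_iff\<close>)
    then have eq: "r \<odot>\<^bsub>E (Suc s)\<^esub> e \<in> d s ` K (k + n) s \<longleftrightarrow> ?m k" for k by (rule bd)
    have "r \<odot>\<^bsub>E (Suc s)\<^esub> e \<in> N \<longleftrightarrow> (\<exists>k. r \<odot>\<^bsub>E (Suc s)\<^esub> e \<in> d s ` K (k + n) s)"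
    proof
      assume "r \<odot>\<^bsub>E (Suc s)\<^esub> e \<in> N"
      then obtain g m where g: "r \<odot>\<^bsub>E (Suc s)\<^esub> e = d s g" "g \<in> K m s" by (auto simp: N_def \<Gamma>_def)
      have "g \<in> K (m + n) s" using mono[OF g(2), of n] by (simp add: add.commute)
      then show "\<exists>k. r \<odot>\<^bsub>E (Suc s)\<^esub> e \<in> d s ` K (k + n) s" using g(1) by blast
    next
      assume "\<exists>k. r \<odot>\<^bsub>E (Suc s)\<^esub> e \<in> d s ` K (k + n) s"
      then show "r \<odot>\<^bsub>E (Suc s)\<^esub> e \<in> N" by (auto simp: N_def \<Gamma>_def)
    qed
    then show ?thesis by (simp only: eq)
  qed
  show ?thesis
    unfolding len carrier_local_cohomology_Suc annihilator_local_cohomology_Suc \<Gamma> N_def[symmetric]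
  proof (intro bexI[of _ "N +>\<^bsub>E (Suc s)\<^esub> e"])
    show "{r \<in> carrier R. (\<Union>y\<in>N +>\<^bsub>E (Suc s)\<^esub> e. N +>\<^bsub>E (Suc s)\<^esub> (r \<odot>\<^bsub>E (Suc s)\<^esub> y)) = N} =
      {r \<in> carrier R. \<exists>k::nat. foldr (\<lambda>a b. a [^] k \<otimes> b) rs \<one> \<odot>\<^bsub>M\<^esub> (r \<odot>\<^bsub>M\<^esub> j) \<in>
         multiples (map (\<lambda>a. a [^] (k + n)) rs)}"
      using E.coset_smult_eq_zero_iff[OF NC N0 Nadd Nsm eC] key by blast
    show "N +>\<^bsub>E (Suc s)\<^esub> e \<in> (+>\<^bsub>E (Suc s)\<^esub>) N ` {e \<in> \<Gamma> (Suc s). d (Suc s) e = \<zero>\<^bsub>E (Suc (Suc s))\<^esub>}"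
      using eK de by (auto simp: \<Gamma>_def)
  qed
qed

end

section \<open>Polynomials as finitely supported functions\<close>

text \<open>Some linear order on the indeterminates gives a lexicographic order on monomials, by which leading monomials
  show that the polynomial ring is an integral domain.\<close>

fun indet_index :: "indet \<Rightarrow> nat" where
  "indet_index Ind_u = 0"
| "indet_index Ind_v = 1"
| "indet_index Ind_w = 2"
| "indet_index Ind_x = 3"
| "indet_index Ind_y = 4"
| "indet_index Ind_z = 5"

lemma indet_index_inject: "indet_index i = indet_index j \<longleftrightarrow> i = j"
  by (cases i; cases j) simp_all

instantiation indet :: linorder
begin

definition "i \<le> j \<longleftrightarrow> indet_index i \<le> indet_index j" for i j :: indet
definition "i < j \<longleftrightarrow> indet_index i < indet_index j" for i j :: indet

instance
  by standard (auto simp: less_eq_indet_def less_indet_def indet_index_inject[symmetric])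

end

abbreviation (input) lookup where "lookup \<equiv> Poly_Mapping.lookup"
abbreviation (input) single where "single \<equiv> Poly_Mapping.single"
abbreviation (input) keys where "keys \<equiv> Poly_Mapping.keys"

lemma poly_mapping_eq_sum_single: "F = (\<Sum>m\<in>keys F. single m (lookup F m))"
proof (rule poly_mapping_eqI)
  fix k
  have "lookup (\<Sum>m\<in>keys F. single m (lookup F m)) k = (\<Sum>m\<in>keys F. if m = k then lookup F k else 0)"
    unfolding lookup_sum by (rule sum.cong) (auto simp: lookup_single when_def)
  also have "\<dots> = lookup F k"
    by (simp add: sum.delta in_keys_iff)
  finally show "lookup F k = lookup (\<Sum>m\<in>keys F. single m (lookup F m)) k" ..
qed

lemma poly_mapping_additive_induct [case_names zero single add]:
  assumes "P 0" "\<And>m c. P (single m c)" "\<And>F G. P F \<Longrightarrow> P G \<Longrightarrow> P (F + G)"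
  shows "P (F :: 'i \<Rightarrow>\<^sub>0 'k::comm_monoid_add)"
proof -
  have "P (\<Sum>m\<in>S. single m (lookup F m))" if "finite S" for S
    using that by (induction S) (auto intro: assms)
  then show ?thesis using poly_mapping_eq_sum_single[of F] by (metis finite_keys)
qed

lemma lookup_single_mult:
  fixes F :: "'i::cancel_comm_monoid_add \<Rightarrow>\<^sub>0 'k::comm_semiring_1"
  shows "lookup (single m 1 * F) (m + m') = lookup F m'"
  by (induction F rule: poly_mapping_additive_induct)
    (simp_all add: mult_single lookup_single when_def distrib_left lookup_add)

text \<open>The \<open>K\<close>-linear map from polynomials with prescribed values on monomials. The target is \<open>K[T][S]\<close>; the constant
  \<open>c\<close> of \<open>K\<close> is \<open>[:[:c:]:]\<close> there.\<close>

definition linear_extension :: "('i \<Rightarrow> 'k poly poly) \<Rightarrow> ('i \<Rightarrow>\<^sub>0 'k::comm_ring_1) \<Rightarrow> 'k poly poly" where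
  "linear_extension l F = (\<Sum>m\<in>keys F. [:[:lookup F m:]:] * l m)"

lemma linear_extension_superset: "\<lbrakk>finite S; keys F \<subseteq> S\<rbrakk> \<Longrightarrow> linear_extension l F = (\<Sum>m\<in>S. [:[:lookup F m:]:] * l m)"
  unfolding linear_extension_def by (rule sum.mono_neutral_left) (auto simp: in_keys_iff)

lemma linear_extension_zero [simp]: "linear_extension l 0 = 0"
  by (simp add: linear_extension_def)

lemma linear_extension_single [simp]: "linear_extension l (single m c) = [:[:c:]:] * l m"
  by (simp add: linear_extension_superset[of "{m}"])

lemma linear_extension_add [simp]:
  fixes F G :: "'i \<Rightarrow>\<^sub>0 'k::comm_ring_1"
  shows "linear_extension l (F + G) = linear_extension l F + linear_extension l G"
proof -
  have "[:[:a + b:]:] = [:[:a:]:] + [:[:b:]:]" for a b :: 'k by simp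
  then show ?thesis
    using linear_extension_superset[of "keys F \<union> keys G" F l] linear_extension_superset[of "keys F \<union> keys G" G l]
      linear_extension_superset[of "keys F \<union> keys G" "F + G" l] Poly_Mapping.keys_add[of F G]
    by (simp add: lookup_add sum.distrib[symmetric] distrib_right del: add_pCons)
qed

lemma linear_extension_diff [simp]: "linear_extension l (F - G) = linear_extension l F - linear_extension l G"
  using linear_extension_add[of l "F - G" G] by (simp add: algebra_simps del: linear_extension_add)

lemma linear_extension_sum: "linear_extension l (sum F S) = (\<Sum>s\<in>S. linear_extension l (F s))"
  by (induction S rule: infinite_finite_induct) simp_all

lemma linear_extension_diff_left: "linear_extension (\<lambda>m. l m - l' m) F = linear_extension l F - linear_extension l' F"
  by (simp add: linear_extension_def right_diff_distrib sum_subtractf)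

lemma linear_extension_add_left: "linear_extension (\<lambda>m. l m + l' m) F = linear_extension l F + linear_extension l' F"
  by (simp add: linear_extension_def distrib_left sum.distrib)

lemma linear_extension_mult_left: "linear_extension (\<lambda>m. l m * c) F = linear_extension l F * c"
  by (simp add: linear_extension_def sum_distrib_right mult.assoc)

lemma linear_extension_single_mult: "linear_extension l (single m 1 * F) = linear_extension (\<lambda>m'. l (m + m')) F"
  for F :: "'i::comm_monoid_add \<Rightarrow>\<^sub>0 'k::comm_ring_1"
  by (induction F rule: poly_mapping_additive_induct) (simp_all add: mult_single distrib_left)

lemma linear_extension_dvd: "(\<And>m. d dvd l m) \<Longrightarrow> d dvd linear_extension l F"
  unfolding linear_extension_def by (intro dvd_sum dvd_mult)

lemma linear_extension_mult:
  fixes F G :: "'i::comm_monoid_add \<Rightarrow>\<^sub>0 'k::comm_ring_1"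
  assumes "\<And>m m'. l (m + m') = l m * l m'"
  shows "linear_extension l (F * G) = linear_extension l F * linear_extension l G"
proof (induction F rule: poly_mapping_additive_induct)
  case (single m c)
  show ?case
  proof (induction G rule: poly_mapping_additive_induct)
    case (single m' c')
    have "[:[:c * c':]:] = [:[:c:]:] * [:[:c':]:]" by simp
    then show ?case by (simp only: mult_single linear_extension_single assms mult_ac)
  qed (simp_all add: distrib_left)
qed (simp_all add: distrib_right)

lemma indet_var_power: "indet_var i ^ n = single (single i n) 1"
  by (induction n) (simp_all add: indet_var_def mult_single single_add[symmetric] flip: single_one)

lemma indet_var_power_dvd_iff:
  fixes F :: "'k::field polyA"
  shows "indet_var i ^ n dvd F \<longleftrightarrow> (\<forall>m\<in>keys F. n \<le> lookup m i)"
proof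
  assume "indet_var i ^ n dvd F"
  then obtain G where G: "F = single (single i n) 1 * G" by (auto simp: indet_var_power)
  have "lookup (single (single i n) 1 * G) m = 0" if "lookup m i < n" for m
    using that
    by (induction G rule: poly_mapping_additive_induct)
      (auto simp: mult_single lookup_single when_def distrib_left lookup_add)
  then show "\<forall>m\<in>keys F. n \<le> lookup m i"
    unfolding G by (metis in_keys_iff not_le)
next
  assume F: "\<forall>m\<in>keys F. n \<le> lookup m i"
  have "single (single i n) 1 dvd single m (lookup F m)" if "m \<in> keys F" for m
  proof -
    have "m = single i n + (m - single i n)"
      using F that by (intro poly_mapping_eqI) (auto simp: lookup_add lookup_minus lookup_single when_def)
    then have "single m (lookup F m) = single (single i n) 1 * single (m - single i n) (lookup F m)"
      by (simp add: mult_single)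
    then show ?thesis by (rule dvdI)
  qed
  then show "indet_var i ^ n dvd F"
    unfolding indet_var_power by (subst poly_mapping_eq_sum_single) (intro dvd_sum)
qed

lemma indet_var_power_dvd_cancel:
  fixes F :: "'k::field polyA"
  assumes "i \<noteq> j" "indet_var i ^ n dvd indet_var j ^ k * F"
  shows "indet_var i ^ n dvd F"
  unfolding indet_var_power_dvd_iff
proof
  fix m assume "m \<in> keys F"
  then have "single j k + m \<in> keys (indet_var j ^ k * F)"
    by (simp add: in_keys_iff indet_var_power lookup_single_mult)
  then have "n \<le> lookup (single j k + m) i"
    using assms(2) unfolding indet_var_power_dvd_iff by blast
  then show "n \<le> lookup m i" using assms(1) by (simp add: lookup_add lookup_single when_def)
qed

section \<open>Identities modulo \<open>f\<close> and powers of \<open>x\<close> and \<open>y\<close>\<close>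

definition power_ideal :: "'a::comm_ring_1 \<Rightarrow> 'a \<Rightarrow> 'a \<Rightarrow> nat \<Rightarrow> 'a set" where
  "power_ideal f x y k = {f * a + x ^ k * b + y ^ k * c |a b c. True}"

lemma power_ideal_mem:
  "r \<in> power_ideal f x y k \<longleftrightarrow> (\<exists>a b c. r = f * a + x ^ k * b + y ^ k * c)"
  by (auto simp: power_ideal_def)

lemma power_ideal_add:
  assumes "r \<in> power_ideal f x y k" "s \<in> power_ideal f x y k"
  shows "r + s \<in> power_ideal f x y k"
proof -
  obtain a b c a' b' c' where "r = f * a + x ^ k * b + y ^ k * c" "s = f * a' + x ^ k * b' + y ^ k * c'"
    using assms by (auto simp: power_ideal_def)
  then have "r + s = f * (a + a') + x ^ k * (b + b') + y ^ k * (c + c')" by (simp add: algebra_simps)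
  then show ?thesis unfolding power_ideal_mem by blast
qed

lemma power_ideal_mult:
  assumes "s \<in> power_ideal f x y k"
  shows "r * s \<in> power_ideal f x y k"
proof -
  obtain a b c where "s = f * a + x ^ k * b + y ^ k * c" using assms by (auto simp: power_ideal_def)
  then have "r * s = f * (r * a) + x ^ k * (r * b) + y ^ k * (r * c)" by (simp add: algebra_simps)
  then show ?thesis unfolding power_ideal_mem by blast
qed

text \<open>The transition map of the direct system \<open>A/(f, x\<^sup>k, y\<^sup>k)\<close>.\<close>

lemma power_ideal_shift:
  assumes "s \<in> power_ideal f x y k"
  shows "(x * y) ^ j * s \<in> power_ideal f x y (j + k)"
proof -
  obtain a b c where "s = f * a + x ^ k * b + y ^ k * c" using assms by (auto simp: power_ideal_def)
  then have "(x * y) ^ j * s = f * ((x * y) ^ j * a) + x ^ (j + k) * (y ^ j * b) + y ^ (j + k) * (x ^ j * c)"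
    by (simp add: algebra_simps power_add power_mult_distrib)
  then show ?thesis unfolding power_ideal_mem by blast
qed

text \<open>The form \<open>\<tau> = (w\<^sup>n - z\<^sup>n)/(w - z)\<close>.\<close>

definition geometric_form :: "'a::comm_ring_1 \<Rightarrow> 'a \<Rightarrow> nat \<Rightarrow> 'a" where
  "geometric_form w z n = (\<Sum>l<n. w ^ (n - Suc l) * z ^ l)"

context
  fixes u v w x y z :: "'a::comm_ring_1" and q n :: nat and f :: 'a
  assumes n: "n = Suc q"
    and f: "f = (v * x - u * y) * (w * v * x - z * u * y)"
begin

lemma kills_y: "y * (v * x * (u * y) ^ q) \<in> power_ideal f x y n"
proof -
  have "y * (v * x * (u * y) ^ q) = f * 0 + x ^ n * 0 + y ^ n * (v * x * u ^ q)"
    by (simp add: n power_mult_distrib algebra_simps)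
  then show ?thesis unfolding power_ideal_mem by blast
qed

lemma factor_dvd: "w * v * x - z * u * y dvd (w * v * x) ^ l - (z * u * y) ^ l"
  by (simp add: power_diff_sumr2)

text \<open>From \<open>w \<delta>\<^bsub>i+1\<^esub> = z \<delta>\<^sub>i\<close> modulo \<open>f\<close>: \<open>z\<^sup>q \<delta>\<^sub>0 = w\<^sup>q \<delta>\<^sub>q\<close>, which trades the power of \<open>y\<close> for a power of \<open>x\<close>.\<close>

lemma shift_to_x:
  obtains s where "z ^ q * (v * x * (u * y) ^ q) =
    z ^ q * (u * y) ^ n + (v * x - u * y) * w ^ q * (v * x) ^ q - f * s"
proof -
  obtain s where s: "(w * v * x) ^ q - (z * u * y) ^ q = (w * v * x - z * u * y) * s"
    using factor_dvd by (blast elim: dvdE)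
  have "z ^ q * (u * y) ^ q = (z * u * y) ^ q" by (simp add: power_mult_distrib mult.assoc)
  also have "\<dots> = (w * v * x) ^ q - (w * v * x - z * u * y) * s" using s by (simp add: algebra_simps)
  also have "(w * v * x) ^ q = w ^ q * (v * x) ^ q" by (simp add: power_mult_distrib mult.assoc)
  finally have e: "z ^ q * (u * y) ^ q = w ^ q * (v * x) ^ q - (w * v * x - z * u * y) * s" .
  have "z ^ q * (v * x * (u * y) ^ q) = z ^ q * (u * y) ^ n + (v * x - u * y) * (z ^ q * (u * y) ^ q)"
    by (simp add: n algebra_simps)
  also have "\<dots> = z ^ q * (u * y) ^ n + (v * x - u * y) * w ^ q * (v * x) ^ q - f * s"
    unfolding e f by (simp add: algebra_simps)
  finally show thesis by (rule that)
qed

lemma kills_x: "x * (z ^ n * (v * x * (u * y) ^ q)) \<in> power_ideal f x y n"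
proof -
  obtain s where s: "z ^ q * (v * x * (u * y) ^ q) =
    z ^ q * (u * y) ^ n + (v * x - u * y) * w ^ q * (v * x) ^ q - f * s" by (rule shift_to_x)
  have "x * (z ^ n * (v * x * (u * y) ^ q)) = x * z * (z ^ q * (v * x * (u * y) ^ q))"
    by (simp add: n algebra_simps)
  also have "\<dots> = f * (- x * z * s) + x ^ n * (z * (v * x - u * y) * w ^ q * v ^ q) + y ^ n * (x * z * z ^ q * u ^ n)"
    unfolding s by (simp add: n algebra_simps power_mult_distrib)
  finally show ?thesis unfolding power_ideal_mem by blast
qed

text \<open>Since \<open>u x y = x Y\<close>, there is room for the further relation \<open>x X\<^sup>q f\<close>, whose first two terms are multiples of
  \<open>x\<^bsup>n+1\<^esup>\<close>. It shows that \<open>z\<close> kills the class of \<open>x X\<^sup>q Y\<^sup>2\<close>.\<close>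

lemma kills_u: "x * y * (u * (z ^ n * (v * x * (u * y) ^ q))) \<in> power_ideal f x y (Suc n)"
proof -
  obtain s where s: "z ^ q * (v * x * (u * y) ^ q) =
    z ^ q * (u * y) ^ n + (v * x - u * y) * w ^ q * (v * x) ^ q - f * s" by (rule shift_to_x)
  have "x * y * (u * (z ^ n * (v * x * (u * y) ^ q))) = x * y * u * z * (z ^ q * (v * x * (u * y) ^ q))"
    by (simp add: n algebra_simps)
  also have "\<dots> = f * (- x * y * u * z * s - w ^ q * (v * x) ^ q * x) +
      x ^ Suc n * (w ^ q * (z * u * y * v ^ n + w * v ^ (q + 2) * x - (w + z) * v ^ n * u * y)) +
      y ^ Suc n * (x * u * z * z ^ q * u ^ n)"
    unfolding s f by (simp add: n algebra_simps power_mult_distrib)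
  finally show ?thesis unfolding power_ideal_mem by blast
qed

text \<open>Multiplying the sum of all \<open>\<delta>\<^sub>i\<close> by \<open>w\<^sup>q\<close> turns it into \<open>\<tau> \<delta>\<^sub>0\<close> modulo \<open>f\<close>, while the sum telescopes to
  \<open>X\<^sup>n - Y\<^sup>n\<close>.\<close>

lemma kills_geometric_form: "geometric_form w z n * (v * x * (u * y) ^ q) \<in> power_ideal f x y n"
proof -
  let ?X = "v * x" and ?Y = "u * y"
  have L: "w * ?X - z * ?Y dvd geometric_form w z n * ?Y ^ q - w ^ q * (\<Sum>l<n. ?Y ^ (n - Suc l) * ?X ^ l)"
  proof -
    have "geometric_form w z n * ?Y ^ q - w ^ q * (\<Sum>l<n. ?Y ^ (n - Suc l) * ?X ^ l) =
      (\<Sum>l<n. w ^ (n - Suc l) * z ^ l * ?Y ^ q - w ^ q * (?Y ^ (n - Suc l) * ?X ^ l))"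
      unfolding geometric_form_def by (simp add: sum_distrib_left sum_distrib_right sum_subtractf)
    also have "\<dots> = (\<Sum>l<n. w ^ (n - Suc l) * ?Y ^ (n - Suc l) * ((z * ?Y) ^ l - (w * ?X) ^ l))"
    proof (rule sum.cong)
      fix l assume "l \<in> {..<n}"
      then have "q = (n - Suc l) + l" using n by auto
      then have "?Y ^ q = ?Y ^ (n - Suc l) * ?Y ^ l" "w ^ q = w ^ (n - Suc l) * w ^ l"
        by (metis power_add)+
      then show "w ^ (n - Suc l) * z ^ l * ?Y ^ q - w ^ q * (?Y ^ (n - Suc l) * ?X ^ l) =
          w ^ (n - Suc l) * ?Y ^ (n - Suc l) * ((z * ?Y) ^ l - (w * ?X) ^ l)"
        by (simp add: power_mult_distrib algebra_simps)
    qed simp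
    also have "w * ?X - z * ?Y dvd \<dots>"
    proof (intro dvd_sum dvd_mult)
      fix l
      have "w * ?X - z * ?Y dvd (w * ?X) ^ l - (z * ?Y) ^ l" by (simp add: power_diff_sumr2)
      then show "w * ?X - z * ?Y dvd (z * ?Y) ^ l - (w * ?X) ^ l" by (metis dvd_minus_iff minus_diff_eq)
    qed
    finally show ?thesis .
  qed
  obtain s where s: "geometric_form w z n * ?Y ^ q - w ^ q * (\<Sum>l<n. ?Y ^ (n - Suc l) * ?X ^ l) = (w * ?X - z * ?Y) * s"
    using L by (blast elim: dvdE)
  have XY: "(?X - ?Y) * (\<Sum>l<n. ?Y ^ (n - Suc l) * ?X ^ l) = ?X ^ n - ?Y ^ n"
    by (simp add: power_diff_sumr2)
  have "geometric_form w z n * (?X * ?Y ^ q) = geometric_form w z n * ?Y ^ n + (?X - ?Y) * (geometric_form w z n * ?Y ^ q)" by (simp add: n algebra_simps)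
  also have "geometric_form w z n * ?Y ^ q = w ^ q * (\<Sum>l<n. ?Y ^ (n - Suc l) * ?X ^ l) + (w * ?X - z * ?Y) * s"
    using s by (simp add: algebra_simps)
  also have "(?X - ?Y) * (w ^ q * (\<Sum>l<n. ?Y ^ (n - Suc l) * ?X ^ l) + (w * ?X - z * ?Y) * s) =
      w ^ q * ((?X - ?Y) * (\<Sum>l<n. ?Y ^ (n - Suc l) * ?X ^ l)) + f * s"
    unfolding f by (simp add: algebra_simps)
  also have "geometric_form w z n * ?Y ^ n + (w ^ q * ((?X - ?Y) * (\<Sum>l<n. ?Y ^ (n - Suc l) * ?X ^ l)) + f * s) =
      f * s + x ^ n * (w ^ q * v ^ n) + y ^ n * ((geometric_form w z n - w ^ q) * u ^ n)"
    unfolding XY by (simp add: algebra_simps power_mult_distrib)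
  finally show ?thesis unfolding power_ideal_mem by blast
qed

text \<open>The relation \<open>y Y\<^sup>q f\<close> shows that \<open>w\<close> kills the element multiplied by \<open>v\<close>. As \<open>\<tau>\<close> kills it too and
  \<open>\<tau> = z\<^sup>q\<close> modulo \<open>w\<close>, so does \<open>z\<^sup>q\<close>.\<close>

lemma kills_v: "x * y * (v * (z ^ n * (v * x * (u * y) ^ q))) \<in> power_ideal f x y (Suc n)"
proof -
  let ?e = "x * y * (v * (v * x * (u * y) ^ q))"
  have "w * ?e = f * ((u * y) ^ q * y) + x ^ Suc n * 0 +
      y ^ Suc n * ((w + z) * v * x * u ^ n - z * u ^ (q + 2) * y)"
    unfolding f by (simp add: n algebra_simps power_mult_distrib)
  then have we: "w * ?e \<in> power_ideal f x y (Suc n)" unfolding power_ideal_mem by blast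
  have te: "geometric_form w z n * ?e \<in> power_ideal f x y (Suc n)"
    using power_ideal_mult[OF power_ideal_shift[OF kills_geometric_form, of 1], of v] by (simp add: algebra_simps)
  have gf: "geometric_form w z n = z ^ q + w * (\<Sum>l<q. w ^ (q - Suc l) * z ^ l)"
  proof -
    have "geometric_form w z n = (\<Sum>l<q. w ^ (q - l) * z ^ l) + z ^ q" unfolding geometric_form_def n by simp
    also have "(\<Sum>l<q. w ^ (q - l) * z ^ l) = (\<Sum>l<q. w * (w ^ (q - Suc l) * z ^ l))"
    proof (rule sum.cong)
      fix l assume "l \<in> {..<q}"
      then have "q - l = Suc (q - Suc l)" by auto
      then show "w ^ (q - l) * z ^ l = w * (w ^ (q - Suc l) * z ^ l)" by (simp add: mult.assoc)
    qed simp
    finally show ?thesis by (simp add: sum_distrib_left)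
  qed
  have eq: "x * y * (v * (z ^ n * (v * x * (u * y) ^ q))) =
      z * (geometric_form w z n * ?e) + (- z * (\<Sum>l<q. w ^ (q - Suc l) * z ^ l)) * (w * ?e)"
    unfolding gf by (simp add: n algebra_simps)
  show ?thesis unfolding eq by (intro power_ideal_add power_ideal_mult te we)
qed

end

section \<open>Homogeneous forms in \<open>w\<close> and \<open>z\<close>\<close>

definition homogenize :: "nat \<Rightarrow> 'k::field poly \<Rightarrow> 'k polyA" where
  "homogenize k h = (\<Sum>i\<le>k. single (single Ind_w i + single Ind_z (k - i)) (coeff h i))"

lemma homogenize_0 [simp]: "homogenize k 0 = 0"
  by (simp add: homogenize_def)

lemma homogenize_add: "homogenize k (g + h) = homogenize k g + homogenize k h"
  by (simp add: homogenize_def single_add sum.distrib)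

lemma homogenize_smult:
  assumes "degree h \<le> b"
  shows "homogenize (a + b) (Polynomial.smult c h) = single (single Ind_z a) c * homogenize b h"
proof -
  have "homogenize (a + b) (Polynomial.smult c h) =
    (\<Sum>i\<le>b. single (single Ind_w i + single Ind_z (a + b - i)) (c * coeff h i))"
    unfolding homogenize_def coeff_smult
    by (rule sum.mono_neutral_right) (use assms in \<open>auto simp: coeff_eq_0\<close>)
  also have "\<dots> = (\<Sum>i\<le>b. single (single Ind_z a) c * single (single Ind_w i + single Ind_z (b - i)) (coeff h i))"
  proof (rule sum.cong)
    fix i assume "i \<in> {..b}"
    then have "a + b - i = a + (b - i)" by auto
    then show "single (single Ind_w i + single Ind_z (a + b - i)) (c * coeff h i) =
      single (single Ind_z a) c * single (single Ind_w i + single Ind_z (b - i)) (coeff h i)"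
      by (simp add: mult_single single_add add_ac)
  qed simp
  finally show ?thesis by (simp add: homogenize_def sum_distrib_left)
qed

lemma homogenize_pCons_0: "homogenize (Suc k) (pCons 0 h) = single (single Ind_w 1) 1 * homogenize k h"
proof -
  have "homogenize (Suc k) (pCons 0 h) = (\<Sum>i\<le>k. single (single Ind_w (Suc i) + single Ind_z (k - i)) (coeff h i))"
    unfolding homogenize_def by (subst sum.atMost_Suc_shift) simp
  also have "\<dots> = (\<Sum>i\<le>k. single (single Ind_w 1) 1 * single (single Ind_w i + single Ind_z (k - i)) (coeff h i))"
    by (simp add: mult_single single_add[symmetric] add.assoc[symmetric])
  finally show ?thesis by (simp add: homogenize_def sum_distrib_left)
qed

lemma homogenize_mult:
  assumes "degree g \<le> a" "degree h \<le> b"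
  shows "homogenize (a + b) (g * h) = homogenize a g * homogenize b h"
  using assms(1)
proof (induction a arbitrary: g)
  case 0
  then obtain c where g: "g = [:c:]" by (auto elim: degree_eq_zeroE)
  have "homogenize 0 g = single (single Ind_z 0) c" by (simp add: g homogenize_def)
  then show ?case using homogenize_smult[OF assms(2), of 0 c] by (simp add: g)
next
  case (Suc a)
  obtain c g' where g: "g = pCons c g'" by (cases g)
  have g': "degree g' \<le> a" using Suc.prems by (auto simp: g split: if_splits)
  have "homogenize (Suc a) g = homogenize (Suc a + 0) (Polynomial.smult c 1) + homogenize (Suc a) (pCons 0 g')"
  proof -
    have "g = Polynomial.smult c 1 + pCons 0 g'" by (simp add: g one_pCons)
    then show ?thesis by (metis homogenize_add add_0_right)
  qed
  also have "\<dots> = single (single Ind_z (Suc a)) c + single (single Ind_w 1) 1 * homogenize a g'"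
    by (subst homogenize_smult) (simp_all add: homogenize_pCons_0, simp add: homogenize_def)
  finally have hg: "homogenize (Suc a) g = \<dots>" .
  have "homogenize (Suc a + b) (g * h) = homogenize (Suc a + b) (Polynomial.smult c h) + homogenize (Suc (a + b)) (pCons 0 (g' * h))"
    unfolding g mult_pCons_left homogenize_add by simp
  also have "\<dots> = single (single Ind_z (Suc a)) c * homogenize b h + single (single Ind_w 1) 1 * (homogenize a g' * homogenize b h)"
    by (simp only: homogenize_smult[OF assms(2)] homogenize_pCons_0 Suc.IH[OF g'])
  finally show ?case unfolding hg by (simp add: algebra_simps)
qed

lemma homogenize_monom:
  assumes "i \<le> k"
  shows "homogenize k (monom c i) = single (single Ind_w i + single Ind_z (k - i)) c"
proof -
  have "homogenize k (monom c i) = (\<Sum>j\<le>k. if j = i then single (single Ind_w i + single Ind_z (k - i)) c else 0)"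
    unfolding homogenize_def by (rule sum.cong) auto
  then show ?thesis using assms by simp
qed

text \<open>The values on monomials of the ring homomorphism \<open>dehomogenize\<close> from \<open>A\<close> to \<open>K[T][S]\<close> that sends \<open>u, v, x, y\<close> to 0,
  \<open>w\<close> to \<open>T S\<close> and \<open>z\<close> to \<open>S\<close>. It is injective on \<open>K[w, z]\<close>, and the power of \<open>S\<close> keeps track of the degree:
  a form is a multiple of a homogenization \<open>P\<close> of \<open>p\<close> iff its image is a multiple of \<open>p\<close>. Thus divisibility
  of forms is reduced to polynomials in one variable over a field.\<close>

definition dehomogenized_monomial :: "(indet \<Rightarrow>\<^sub>0 nat) \<Rightarrow> 'k::comm_ring_1 poly poly" where
  "dehomogenized_monomial m = (if lookup m Ind_u = 0 \<and> lookup m Ind_v = 0 \<and> lookup m Ind_x = 0 \<and> lookup m Ind_y = 0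
    then monom (monom 1 (lookup m Ind_w)) (lookup m Ind_w + lookup m Ind_z) else 0)"

definition dehomogenize :: "'k::field polyA \<Rightarrow> 'k poly poly" where
  "dehomogenize = linear_extension dehomogenized_monomial"

lemma dehomogenize_mult: "dehomogenize (F * G) = dehomogenize F * dehomogenize G"
  unfolding dehomogenize_def by (rule linear_extension_mult) (auto simp: dehomogenized_monomial_def lookup_add mult_monom add_ac)

lemma dehomogenize_add: "dehomogenize (F + G) = dehomogenize F + dehomogenize G" and dehomogenize_0 [simp]: "dehomogenize 0 = 0"
  by (simp_all add: dehomogenize_def)

lemma dehomogenize_1 [simp]: "dehomogenize 1 = 1"
  unfolding dehomogenize_def single_one[symmetric] linear_extension_single by (simp add: dehomogenized_monomial_def one_pCons monom_0)

lemma dehomogenize_homogenize: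
  assumes "degree h \<le> k"
  shows "dehomogenize (homogenize k h) = monom h k"
proof -
  have "dehomogenize (homogenize k h) = (\<Sum>i\<le>k. [:[:coeff h i:]:] * monom (monom 1 i) k)"
    unfolding dehomogenize_def homogenize_def linear_extension_sum linear_extension_single
    by (rule sum.cong) (auto simp: dehomogenized_monomial_def lookup_add lookup_single when_def)
  also have "\<dots> = (\<Sum>i\<le>k. monom (monom (coeff h i) i) k)"
    by (simp add: smult_monom)
  also have "\<dots> = monom (\<Sum>i\<le>k. monom (coeff h i) i) k"
    by (rule poly_eqI) (simp add: coeff_sum)
  also have "(\<Sum>i\<le>k. monom (coeff h i) i) = h"
    using assms by (rule poly_as_sum_of_monoms')
  finally show ?thesis .
qed

lemma degree_coeff_dehomogenize: "degree (coeff (dehomogenize F) k) \<le> k"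
proof (induction F rule: poly_mapping_additive_induct)
  case (single m c)
  show ?case
    unfolding dehomogenize_def linear_extension_single
    by (auto simp: dehomogenized_monomial_def smult_monom intro: order_trans[OF degree_monom_le])
next
  case (add F G)
  then show ?case by (simp add: dehomogenize_add degree_add_le)
qed simp

text \<open>Modulo \<open>(u, v, x, y)\<close> a polynomial is the sum of its homogeneous parts in \<open>w\<close> and \<open>z\<close>, and these can be recovered
  from its image under \<open>dehomogenize\<close>. The bound \<open>K0\<close> leaves the number of parts open, which makes the claim additive.\<close>

lemma reduce_to_homogenized:
  fixes Z :: "'k::field polyA set"
  assumes plus: "\<And>a b. a \<in> Z \<Longrightarrow> b \<in> Z \<Longrightarrow> a + b \<in> Z" and mult: "\<And>r a. a \<in> Z \<Longrightarrow> r * a \<in> Z"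
    and vars: "indet_var Ind_u \<in> Z" "indet_var Ind_v \<in> Z" "indet_var Ind_x \<in> Z" "indet_var Ind_y \<in> Z"
  shows "\<exists>K0. \<forall>K\<ge>K0. F - (\<Sum>k\<le>K. homogenize k (coeff (dehomogenize F) k)) \<in> Z"
proof (induction F rule: poly_mapping_additive_induct)
  case zero
  have "0 \<in> Z" using mult[OF vars(1), of 0] by simp
  then show ?case by simp
next
  case (single m c)
  have *: ?case if i: "lookup m i \<noteq> 0" "i \<in> {Ind_u, Ind_v, Ind_x, Ind_y}" for i
  proof -
    have "m = single i 1 + (m - single i 1)"
      using i by (intro poly_mapping_eqI) (auto simp: lookup_add lookup_minus lookup_single when_def)
    then have "single m c = single (m - single i 1) c * indet_var i"
      by (simp add: indet_var_def mult_single add.commute)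
    moreover have "indet_var i \<in> Z" using i vars by auto
    ultimately have "single m c \<in> Z" using mult by metis
    moreover have "dehomogenize (single m c) = 0" using i by (auto simp: dehomogenize_def dehomogenized_monomial_def)
    ultimately show ?thesis by simp
  qed
  show ?case
  proof (cases "lookup m Ind_u = 0 \<and> lookup m Ind_v = 0 \<and> lookup m Ind_x = 0 \<and> lookup m Ind_y = 0")
    case True
    define i j where "i = lookup m Ind_w" and "j = lookup m Ind_z"
    have m: "m = single Ind_w i + single Ind_z j"
    proof (rule poly_mapping_eqI)
      fix l show "lookup m l = lookup (single Ind_w i + single Ind_z j) l"
        by (cases l) (use True in \<open>auto simp: i_def j_def lookup_add lookup_single\<close>)
    qed
    have dehomogenize: "dehomogenize (single m c) = monom (monom c i) (i + j)"
      using True by (simp add: dehomogenize_def dehomogenized_monomial_def i_def j_def smult_monom)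
    have "(\<Sum>k\<le>K. homogenize k (coeff (dehomogenize (single m c)) k)) = single m c" if "K \<ge> i + j" for K
    proof -
      have "(\<Sum>k\<le>K. homogenize k (coeff (dehomogenize (single m c)) k)) = (\<Sum>k\<le>K. if k = i + j then single m c else 0)"
        unfolding dehomogenize by (rule sum.cong) (auto simp: homogenize_monom m)
      then show ?thesis using that by simp
    qed
    moreover have "0 \<in> Z" using mult[OF vars(1), of 0] by simp
    ultimately show ?thesis by (intro exI[of _ "i + j"]) simp
  next
    case False
    then show ?thesis using * by blast
  qed
next
  case (add F G)
  then obtain K1 K2 where K: "\<forall>K\<ge>K1. F - (\<Sum>k\<le>K. homogenize k (coeff (dehomogenize F) k)) \<in> Z"
    "\<forall>K\<ge>K2. G - (\<Sum>k\<le>K. homogenize k (coeff (dehomogenize G) k)) \<in> Z" by blast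
  show ?case
  proof (intro exI[of _ "max K1 K2"] allI impI)
    fix K assume "K \<ge> max K1 K2"
    then have "(F - (\<Sum>k\<le>K. homogenize k (coeff (dehomogenize F) k))) + (G - (\<Sum>k\<le>K. homogenize k (coeff (dehomogenize G) k))) \<in> Z"
      using K by (intro plus) simp_all
    then show "F + G - (\<Sum>k\<le>K. homogenize k (coeff (dehomogenize (F + G)) k)) \<in> Z"
      by (simp add: dehomogenize_add homogenize_add sum.distrib algebra_simps)
  qed
qed

section \<open>A functional that separates the class from zero\<close>

lemma f_poly_factored:
  "f_poly = (indet_var Ind_v * indet_var Ind_x - indet_var Ind_u * indet_var Ind_y) *
    (indet_var Ind_w * indet_var Ind_v * indet_var Ind_x - indet_var Ind_z * indet_var Ind_u * indet_var Ind_y)"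
  by (simp add: f_poly_def Let_def algebra_simps power2_eq_square)

definition geometric_poly :: "nat \<Rightarrow> 'k::field poly" where
  "geometric_poly n = (\<Sum>l<n. monom 1 l)"

text \<open>The values on monomials of a functional on \<open>A\<close> that is only sensitive to the multidegree of \<open>(xy)\<^sup>k X\<^bsup>b\<^esup> Y\<^bsup>n-b\<^esup>\<close>.
  It sends this element to the image of \<open>w\<^bsup>n-1\<^esup> + \<dots> + w\<^bsup>n-b\<^esup> z\<^bsup>b-1\<^esup>\<close> under \<open>dehomogenize\<close>, a solution of the
  recurrence imposed by \<open>f\<close> that starts with 0 at \<open>b = 0\<close> and ends with \<open>\<tau>\<close> at \<open>b = n\<close>.\<close>

definition detector :: "nat \<Rightarrow> nat \<Rightarrow> (indet \<Rightarrow>\<^sub>0 nat) \<Rightarrow> 'k::field poly poly" where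
  "detector n k m = (if lookup m Ind_u + lookup m Ind_v = n \<and> lookup m Ind_x = lookup m Ind_v + k \<and>
      lookup m Ind_y = lookup m Ind_u + k
    then monom (monom 1 (lookup m Ind_w) * (\<Sum>l<lookup m Ind_v. monom 1 (n - Suc l)))
      (lookup m Ind_w + lookup m Ind_z + (n - 1)) else 0)"

lemma geometric_poly_rev: "(\<Sum>l<n. monom 1 (n - Suc l)) = geometric_poly n"
  unfolding geometric_poly_def by (rule sum.nat_diff_reindex)

text \<open>Only \<open>b = n\<close> leaves \<open>x\<close> with exponent at least \<open>k + n\<close>, and there the value is a multiple of \<open>\<tau>\<close>.\<close>

lemma detector_x:
  fixes F :: "'k::field polyA"
  shows "[:geometric_poly n:] dvd linear_extension (detector n k) (indet_var Ind_x ^ (k + n) * F)"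
  unfolding indet_var_power linear_extension_single_mult
proof (rule linear_extension_dvd)
  fix m
  have dvd: "[:g:] dvd monom (h * g) j" for g h :: "'k poly" and j
    by (rule dvdI[of _ _ "monom h j"]) (simp add: smult_monom)
  have "detector n k (single Ind_x (k + n) + m) = (0 :: 'k poly poly) \<or> lookup m Ind_v = n"
    by (auto simp: detector_def lookup_add lookup_single)
  then show "[:geometric_poly n:] dvd (detector n k (single Ind_x (k + n) + m) :: 'k poly poly)"
  proof
    assume "lookup m Ind_v = n"
    then show ?thesis by (simp add: detector_def lookup_add lookup_single geometric_poly_rev dvd)
  qed simp
qed

text \<open>Only \<open>b = 0\<close> leaves \<open>y\<close> with exponent at least \<open>k + n\<close>, and there the value is 0.\<close>

lemma detector_y:
  fixes F :: "'k::field polyA"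
  shows "linear_extension (detector n k) (indet_var Ind_y ^ (k + n) * F) = 0"
proof -
  have "detector n k (single Ind_y (k + n) + m) = (0 :: 'k poly poly)" for m
    by (auto simp: detector_def lookup_add lookup_single)
  then show ?thesis unfolding indet_var_power linear_extension_single_mult by (simp add: linear_extension_def)
qed

lemma detector_f:
  fixes F :: "'k::field polyA"
  shows "linear_extension (detector n k) (f_poly * F) = 0"
proof -
  define m1 m2 m3 m4 where
    "m1 = single Ind_w 1 + (single Ind_v 2 + single Ind_x (2::nat))"
    and "m2 = single Ind_w 1 + (single Ind_v 1 + (single Ind_x 1 + (single Ind_u 1 + single Ind_y (1::nat))))"
    and "m3 = single Ind_z 1 + (single Ind_v 1 + (single Ind_x 1 + (single Ind_u 1 + single Ind_y (1::nat))))"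
    and "m4 = single Ind_z 1 + (single Ind_u 2 + single Ind_y (2::nat))"
  have f: "(f_poly :: 'k polyA) = single m1 1 - single m2 1 - single m3 1 + single m4 1"
    unfolding f_poly_def Let_def indet_var_power
    by (simp add: indet_var_def mult_single distrib_right m1_def m2_def m3_def m4_def add_ac algebra_simps)
  have 0: "detector n k (m1 + m) - detector n k (m2 + m) - detector n k (m3 + m) + detector n k (m4 + m) = (0::'k poly poly)"
    (is "?D = 0") for m
  proof (cases "lookup m Ind_u + lookup m Ind_v + 2 = n \<and> lookup m Ind_x = lookup m Ind_v + k \<and>
      lookup m Ind_y = lookup m Ind_u + k")
    case True
    define a b c e where "a = lookup m Ind_u" and "b = lookup m Ind_v" and "c = lookup m Ind_w" and "e = lookup m Ind_z"
    define S :: "nat \<Rightarrow> 'k poly" where "S b = (\<Sum>l<b. monom 1 (n - Suc l))" for b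
    have n: "n = Suc (Suc (a + b))" using True by (simp add: a_def b_def)
    have "?D = monom (monom 1 (Suc c) * S (b + 2) - monom 1 (Suc c) * S (b + 1)
        - monom 1 c * S (b + 1) + monom 1 c * S b) (Suc c + e + (n - 1))"
      using True
      by (simp add: detector_def m1_def m2_def m3_def m4_def lookup_add lookup_single S_def
          a_def[symmetric] b_def[symmetric] c_def[symmetric] e_def[symmetric] add_monom diff_monom add_ac)
    also have "monom 1 (Suc c) * S (b + 2) - monom 1 (Suc c) * S (b + 1) - monom 1 c * S (b + 1) + monom 1 c * S b =
        monom 1 (Suc c) * monom 1 a - monom 1 c * monom 1 (Suc a)"
      by (simp add: S_def n algebra_simps)
    also have "\<dots> = 0" by (simp add: mult_monom)
    finally show ?thesis by simp
  next
    case False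
    then show ?thesis
      by (auto simp: detector_def m1_def m2_def m3_def m4_def lookup_add lookup_single)
  qed
  have "linear_extension (detector n k) (f_poly * F) =
    linear_extension (\<lambda>m. detector n k (m1 + m) - detector n k (m2 + m) - detector n k (m3 + m) + detector n k (m4 + m)) F"
    unfolding f by (simp add: left_diff_distrib distrib_right linear_extension_single_mult linear_extension_diff_left linear_extension_add_left)
  then show ?thesis by (simp add: 0 linear_extension_def)
qed

lemma detector_power_ideal:
  assumes "r \<in> power_ideal f_poly (indet_var Ind_x) (indet_var Ind_y) (k + n)"
  shows "[:geometric_poly n:] dvd linear_extension (detector n k) r"
proof -
  obtain a b c where "r = f_poly * a + indet_var Ind_x ^ (k + n) * b + indet_var Ind_y ^ (k + n) * c"
    using assms by (auto simp: power_ideal_def)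
  then show ?thesis using detector_x by (simp add: detector_f detector_y)
qed

section \<open>Prime factors of \<open>1 + T + \<dots> + T\<^bsup>n-1\<^esup>\<close>\<close>

lemma geometric_poly_Suc: "geometric_poly (Suc n) = 1 + monom 1 1 * geometric_poly n"
  unfolding geometric_poly_def by (subst sum.lessThan_Suc_shift) (simp add: sum_distrib_left mult_monom)

lemma geometric_poly_add: "geometric_poly (a + b) = geometric_poly a + monom 1 a * geometric_poly b"
  by (induction a) (simp_all add: geometric_poly_Suc geometric_poly_def[of 0] algebra_simps mult_monom
      flip: mult.assoc)

lemma geometric_poly_dvd_mult: "geometric_poly a dvd geometric_poly (a * k)"
  by (induction k) (simp_all add: geometric_poly_add geometric_poly_def[of 0])

lemma degree_geometric_poly: "degree (geometric_poly (Suc q)) \<le> q"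
  unfolding geometric_poly_def by (intro degree_sum_le) (auto intro: order_trans[OF degree_monom_le])

lemma coeff_geometric_poly: "coeff (geometric_poly n) i = (if i < n then 1 else 0)"
  by (simp add: geometric_poly_def coeff_sum)

text \<open>With \<open>m a = n b + 1\<close>, a common factor divides the polynomials of lengths \<open>m a\<close> and \<open>n b\<close>, hence
  the difference 1 of the former and \<open>T\<close> times the latter.\<close>

lemma not_dvd_coprime_geometric_polys:
  assumes "coprime m n" "p dvd geometric_poly m" "p dvd geometric_poly n"
  shows "p dvd 1"
proof (cases "m = 0")
  case True
  then have "n = 1" using assms(1) by simp
  then show ?thesis using assms(3) by (simp add: geometric_poly_def monom_0 one_pCons)
next
  case False
  then obtain a b where "m * a = n * b + gcd m n" using bezout_nat by blast
  then have ab: "m * a = Suc (n * b)" using assms(1) by simp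
  have "p dvd geometric_poly (Suc (n * b))"
    using dvd_trans[OF assms(2) geometric_poly_dvd_mult] unfolding ab[symmetric] .
  moreover have "p dvd monom 1 1 * geometric_poly (n * b)"
    using dvd_trans[OF assms(3) geometric_poly_dvd_mult] by (rule dvd_mult)
  ultimately show ?thesis unfolding geometric_poly_Suc using dvd_add_left_iff by blast
qed

text \<open>A nonconstant divisor of least degree is irreducible.\<close>

lemma exists_prime_factor:
  fixes T :: "'k::field poly"
  assumes "degree T > 0"
  shows "\<exists>p. prime_elem p \<and> p dvd T"
proof -
  define Q where "Q p \<longleftrightarrow> p dvd T \<and> degree p > 0" for p
  have "Q T" using assms by (simp add: Q_def)
  then obtain p where p: "Q p" and min: "\<And>r. Q r \<Longrightarrow> degree p \<le> degree r"
    using ex_has_least_nat[of Q T degree] by blast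
  have "irreducible p"
  proof (rule irreducibleI)
    show nz0: "p \<noteq> 0" using p by (auto simp: Q_def)
    show "\<not> p dvd 1" using p nz0 by (simp add: Q_def is_unit_iff_degree)
    fix a b assume ab: "p = a * b"
    with \<open>p \<noteq> 0\<close> have nz: "a \<noteq> 0" "b \<noteq> 0" by auto
    have deg: "degree p = degree a + degree b" using nz by (simp add: ab degree_mult_eq)
    show "a dvd 1 \<or> b dvd 1"
    proof (cases "degree a = 0")
      case True
      then show ?thesis using nz by (auto simp: is_unit_iff_degree)
    next
      case False
      then have "Q a" using p by (auto simp: Q_def ab dvd_mult_left)
      then have "degree b = 0" using min deg by fastforce
      then show ?thesis using nz by (auto simp: is_unit_iff_degree)
    qed
  qed
  then show ?thesis using p field_poly_irreducible_imp_prime by (auto simp: Q_def)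
qed

section \<open>Annihilators over the hypersurface\<close>

lemma homogenize_sum: "homogenize k (sum h S) = (\<Sum>s\<in>S. homogenize k (h s))"
  by (induction S rule: infinite_finite_induct) (simp_all add: homogenize_add)

lemma homogenize_geometric_poly:
  assumes "n = Suc q"
  shows "homogenize q (geometric_poly n) = geometric_form (indet_var Ind_w) (indet_var Ind_z) n"
proof -
  have "homogenize q (geometric_poly n) = (\<Sum>l<n. indet_var Ind_w ^ l * indet_var Ind_z ^ (q - l))"
    unfolding geometric_poly_def homogenize_sum
    by (rule sum.cong) (auto simp: assms homogenize_monom indet_var_power mult_single)
  also have "\<dots> = (\<Sum>l<n. indet_var Ind_w ^ (n - Suc l) * indet_var Ind_z ^ (q - (n - Suc l)))"
    by (rule sum.nat_diff_reindex[symmetric])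
  also have "\<dots> = (\<Sum>l<n. indet_var Ind_w ^ (n - Suc l) * indet_var Ind_z ^ l)"
    by (rule sum.cong) (auto simp: assms)
  finally show ?thesis by (simp add: geometric_form_def)
qed

text \<open>In \<open>K[w, z]\<close> the cofactor \<open>G\<close> of \<open>p\<close> turns the annihilator \<open>(\<tau>)\<close> into \<open>(P)\<close>, where \<open>P\<close> is the homogenization
  of \<open>p\<close>. If \<open>r\<close> kills the class, the functional shows that \<open>p G\<close> divides the image of \<open>r G\<close> up to powers of \<open>T\<close>
  and \<open>S\<close>. Here \<open>p\<close> does not divide \<open>T\<close>, because \<open>p G\<close> has constant term 1. Conversely the elements killing the
  class form an ideal that contains \<open>u, v, x, y\<close> and \<open>P\<close>.\<close>

lemma annihilator_in_hypersurface:
  fixes p G :: "'k::field poly" and r :: "'k polyA"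
  assumes n: "n = Suc q" and pG: "p * G = geometric_poly n" and p: "prime_elem p"
  defines "g \<equiv> homogenize (q - degree p) G *
    (indet_var Ind_z ^ n * (indet_var Ind_v * indet_var Ind_x * (indet_var Ind_u * indet_var Ind_y) ^ q))"
  shows "(\<exists>k. (indet_var Ind_x * indet_var Ind_y) ^ k * (r * g) \<in>
      power_ideal f_poly (indet_var Ind_x) (indet_var Ind_y) (k + n)) \<longleftrightarrow> [:p:] dvd dehomogenize r"
proof
  define u v w x y z :: "'k polyA"
    where "u = indet_var Ind_u" and "v = indet_var Ind_v" and "w = indet_var Ind_w"
      and "x = indet_var Ind_x" and "y = indet_var Ind_y" and "z = indet_var Ind_z"
  note vars = u_def v_def w_def x_def y_def z_def
  define H where "H = homogenize (q - degree p) G"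
  define W where "W = z ^ n * (v * x * (u * y) ^ q)"
  have g: "g = H * W" by (simp add: g_def H_def W_def vars)
  have nz: "p \<noteq> 0" "G \<noteq> 0"
    using pG coeff_geometric_poly[of n 0, where 'a = 'k] n by auto
  have "degree p + degree G \<le> q"
    using degree_geometric_poly[of q, where 'a = 'k] degree_mult_eq[OF nz] unfolding n[symmetric] pG[symmetric] by simp
  then have deg: "degree p \<le> q" "degree G \<le> q - degree p" by auto
  {
    assume "\<exists>k. (indet_var Ind_x * indet_var Ind_y) ^ k * (r * g) \<in>
      power_ideal f_poly (indet_var Ind_x) (indet_var Ind_y) (k + n)"
    then obtain k where "(x * y) ^ k * (r * g) \<in> power_ideal f_poly x y (k + n)" unfolding vars by blast
    then have "[:geometric_poly n:] dvd linear_extension (detector n k) ((x * y) ^ k * (r * g))"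
      unfolding vars by (rule detector_power_ideal)
    define m where "m = single Ind_x (k + 1) + single Ind_y (k + q) + single Ind_z n + single Ind_v 1 + single Ind_u q"
    have "(x * y) ^ k * (r * g) = (x ^ (k + 1) * y ^ (k + q) * z ^ n * v ^ 1 * u ^ q) * (r * H)"
      by (simp add: g W_def power_mult_distrib power_add mult_ac)
    also have "x ^ (k + 1) * y ^ (k + q) * z ^ n * v ^ 1 * u ^ q = single m 1"
      unfolding vars indet_var_power by (simp add: mult_single m_def)
    finally have eq: "(x * y) ^ k * (r * g) = single m 1 * (r * H)" .
    have "detector n k (m + m') = (dehomogenized_monomial m' * monom (monom 1 q) (n + q) :: 'k poly poly)" for m'
      by (auto simp: detector_def dehomogenized_monomial_def m_def lookup_add lookup_single n mult_monom add_ac)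
    then have "linear_extension (detector n k) ((x * y) ^ k * (r * g)) = dehomogenize (r * H) * monom (monom 1 q) (n + q)"
      unfolding eq linear_extension_single_mult by (simp add: linear_extension_mult_left dehomogenize_def)
    also have "dehomogenize (r * H) = dehomogenize r * monom G (q - degree p)"
      unfolding dehomogenize_mult H_def using deg by (simp add: dehomogenize_homogenize)
    finally have linear_extension: "linear_extension (detector n k) ((x * y) ^ k * (r * g)) =
      [:G:] * (dehomogenize r * monom (monom 1 q) (q - degree p + (n + q)))"
      by (simp add: mult_monom smult_monom mult_ac flip: mult_smult_right)
    have "[:G:] * [:p:] dvd [:G:] * (dehomogenize r * monom (monom 1 q) (q - degree p + (n + q)))"
      using \<open>[:geometric_poly n:] dvd _\<close> unfolding linear_extension pG[symmetric] by (simp add: mult.commute)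
    then have "[:p:] dvd dehomogenize r * monom (monom 1 q) (q - degree p + (n + q))"
      using nz by (subst (asm) dvd_mult_cancel_left) auto
    moreover have "prime_elem [:p:]" using p by (simp add: prime_elem_const_poly_iff)
    moreover have "\<not> [:p:] dvd monom (monom 1 q) (q - degree p + (n + q))"
    proof
      assume "[:p:] dvd monom (monom 1 q) (q - degree p + (n + q))"
      then have "p dvd monom 1 q" unfolding const_poly_dvd_iff by (metis coeff_monom)
      moreover have "monom 1 q = (monom 1 1 :: 'k poly) ^ q" by (simp add: monom_power)
      ultimately have "p dvd monom 1 1" using p prime_elem_dvd_power by metis
      moreover have "p dvd 1 + monom 1 1 * geometric_poly q"
        unfolding geometric_poly_Suc[symmetric] n[symmetric] pG[symmetric] by simp
      ultimately have "p dvd 1" using dvd_add_left_iff dvd_mult2 by metis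
      then show False using p by simp
    qed
    ultimately show "[:p:] dvd dehomogenize r" using prime_elem_dvd_mult_iff by blast
  }
  assume pr: "[:p:] dvd dehomogenize r"
  have f: "f_poly = (v * x - u * y) * (w * v * x - z * u * y)"
    unfolding vars by (rule f_poly_factored)
  define Z where "Z = {r. \<exists>k. (x * y) ^ k * (r * g) \<in> power_ideal f_poly x y (k + n)}"
  have ZI: "a \<in> Z" if "(x * y) ^ k * (a * g) \<in> power_ideal f_poly x y (k + n)" for a k
    using that by (auto simp: Z_def)
  have plus: "a + b \<in> Z" if "a \<in> Z" "b \<in> Z" for a b
  proof -
    obtain k l where k: "(x * y) ^ k * (a * g) \<in> power_ideal f_poly x y (k + n)"
      and l: "(x * y) ^ l * (b * g) \<in> power_ideal f_poly x y (l + n)" using \<open>a \<in> Z\<close> \<open>b \<in> Z\<close> by (auto simp: Z_def)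
    have "(x * y) ^ l * ((x * y) ^ k * (a * g)) + (x * y) ^ k * ((x * y) ^ l * (b * g))
        \<in> power_ideal f_poly x y (l + k + n)"
      using power_ideal_shift[OF k, of l] power_ideal_shift[OF l, of k]
      by (intro power_ideal_add) (simp_all add: add_ac)
    then show ?thesis by (intro ZI[of "l + k"]) (simp add: power_add algebra_simps)
  qed
  have mult: "s * a \<in> Z" if "a \<in> Z" for s a
  proof -
    obtain k where "(x * y) ^ k * (a * g) \<in> power_ideal f_poly x y (k + n)" using \<open>a \<in> Z\<close> by (auto simp: Z_def)
    from power_ideal_mult[OF this, of s] show ?thesis by (intro ZI[of k]) (simp add: mult_ac)
  qed
  note id = n f
  have "u \<in> Z"
    using power_ideal_mult[OF kills_u[OF id], of H] by (intro ZI[of 1]) (simp add: g W_def mult_ac)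
  moreover have "v \<in> Z"
    using power_ideal_mult[OF kills_v[OF id], of H] by (intro ZI[of 1]) (simp add: g W_def mult_ac)
  moreover have "x \<in> Z"
    using power_ideal_mult[OF kills_x[OF id], of H] by (intro ZI[of 0]) (simp add: g W_def mult_ac)
  moreover have "y \<in> Z"
    using power_ideal_mult[OF kills_y[OF id], of "H * z ^ n"] by (intro ZI[of 0]) (simp add: g W_def mult_ac)
  ultimately obtain K where K: "r - (\<Sum>k\<le>K. homogenize k (coeff (dehomogenize r) k)) \<in> Z"
    using reduce_to_homogenized[of Z r] plus mult unfolding vars by blast
  have pZ: "homogenize (degree p) p \<in> Z"
  proof -
    have "homogenize (degree p) p * H = homogenize (degree p + (q - degree p)) (p * G)"
      unfolding H_def by (rule homogenize_mult[symmetric]) (use deg in auto)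
    also have "\<dots> = geometric_form w z n"
      using deg n by (simp add: pG homogenize_geometric_poly vars)
    finally have "homogenize (degree p) p * g = z ^ n * (geometric_form w z n * (v * x * (u * y) ^ q))"
      by (simp add: g W_def mult_ac)
    then show ?thesis using power_ideal_mult[OF kills_geometric_form[OF id], of "z ^ n"] by (intro ZI[of 0]) simp
  qed
  have 0: "0 \<in> Z" using mult[OF pZ, of 0] by simp
  have hZ: "homogenize k (coeff (dehomogenize r) k) \<in> Z" for k
  proof (cases "coeff (dehomogenize r) k = 0")
    case False
    obtain h where h: "coeff (dehomogenize r) k = p * h" using pr unfolding const_poly_dvd_iff by (auto elim: dvdE)
    have "h \<noteq> 0" using False h by auto
    then have d: "degree p + degree h \<le> k"
      using degree_coeff_dehomogenize[of r k] nz by (simp add: h degree_mult_eq)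
    have "homogenize k (coeff (dehomogenize r) k) = homogenize (degree p + (k - degree p)) (p * h)" using d by (simp add: h)
    also have "\<dots> = homogenize (degree p) p * homogenize (k - degree p) h"
      by (rule homogenize_mult) (use d in auto)
    finally show ?thesis using mult[OF pZ, of "homogenize (k - degree p) h"] by (simp only: mult.commute)
  qed (simp add: 0)
  have "(\<Sum>k\<le>K. homogenize k (coeff (dehomogenize r) k)) \<in> Z"
    by (induction K) (simp_all add: hZ plus)
  from plus[OF K this] show "\<exists>k. (indet_var Ind_x * indet_var Ind_y) ^ k * (r * g) \<in>
      power_ideal f_poly (indet_var Ind_x) (indet_var Ind_y) (k + n)"
    by (simp add: Z_def vars)
qed

section \<open>The ring \<open>A[t]\<close> and its ideals\<close>

lemma ring_R_simps [simp]:
  "carrier ring_R = UNIV" "monoid.mult ring_R = (*)" "one ring_R = 1" "zero ring_R = 0" "add ring_R = (+)"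
  by (auto simp: ring_R_def ring_of_type_algebra_def)

lemma cring_ring_R: "cring (ring_R :: 'k::field polyR ring)"
  unfolding ring_R_def by (rule cring_from_type_algebra)

lemma ring_R_power [simp]: "a [^]\<^bsub>ring_R\<^esub> (n::nat) = a ^ n"
proof -
  interpret cring "ring_R :: 'a polyR ring" by (rule cring_ring_R)
  show ?thesis by (induction n) (simp_all add: mult.commute)
qed

lemma Idl_empty: "Idl\<^bsub>ring_R :: 'k::field polyR ring\<^esub> {} = {0}"
proof -
  interpret cring "ring_R :: 'k polyR ring" by (rule cring_ring_R)
  show ?thesis using genideal_minimal[OF zeroideal, of "{}"] additive_subgroup.zero_closed[OF ideal.axioms(1)[OF genideal_ideal, of "{}"]]
    by auto
qed

lemma ideal_ring_RI:
  fixes L :: "'k::field polyR set"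
  assumes "0 \<in> L" "\<And>a b. a \<in> L \<Longrightarrow> b \<in> L \<Longrightarrow> a + b \<in> L" "\<And>r a. a \<in> L \<Longrightarrow> r * a \<in> L"
  shows "ideal L ring_R"
proof -
  interpret cring "ring_R :: 'k polyR ring" by (rule cring_ring_R)
  have minus: "\<ominus>\<^bsub>ring_R\<^esub> a = - a" for a :: "'k polyR"
    by (rule minus_equality) simp_all
  show ?thesis
  proof (rule idealI)
    show "subgroup L (add_monoid ring_R)"
    proof (rule add.subgroupI)
      show "\<ominus>\<^bsub>ring_R\<^esub> a \<in> L" if "a \<in> L" for a
        using assms(3)[OF that, of "- 1"] by (simp add: minus)
    qed (use assms in auto)
  qed (use assms in \<open>auto simp: ring_axioms mult.commute\<close>)
qed

lemma Idl_insert: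
  fixes a :: "'k::field polyR"
  shows "Idl\<^bsub>ring_R\<^esub> (insert a S) = {a * r + s |r s. s \<in> Idl\<^bsub>ring_R\<^esub> S}" (is "?L = ?R")
proof -
  interpret cring "ring_R :: 'k polyR ring" by (rule cring_ring_R)
  interpret S: ideal "Idl\<^bsub>ring_R\<^esub> S" "ring_R :: 'k polyR ring" by (rule genideal_ideal) simp
  interpret L: ideal ?L "ring_R :: 'k polyR ring" by (rule genideal_ideal) simp
  have mem: "z \<in> ?R" if "s \<in> Idl\<^bsub>ring_R\<^esub> S" "z = a * r + s" for z r s
    using that by blast
  have "ideal ?R ring_R"
  proof (rule ideal_ring_RI)
    show "0 \<in> ?R" by (rule mem[OF S.zero_closed, of _ 0]) simp
  next
    fix b c assume "b \<in> ?R" "c \<in> ?R"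
    then obtain r s r' s' where *: "b = a * r + s" "c = a * r' + s'" "s \<in> Idl\<^bsub>ring_R\<^esub> S" "s' \<in> Idl\<^bsub>ring_R\<^esub> S"
      by blast
    show "b + c \<in> ?R"
      by (rule mem[OF S.a_closed[OF *(3,4)], of _ "r + r'"]) (simp add: * algebra_simps)
  next
    fix r b assume "b \<in> ?R"
    then obtain r' s where *: "b = a * r' + s" "s \<in> Idl\<^bsub>ring_R\<^esub> S" by blast
    show "r * b \<in> ?R"
      by (rule mem[OF S.I_l_closed[OF *(2), of r], of _ "r * r'"]) (simp_all add: * algebra_simps)
  qed
  moreover have "insert a S \<subseteq> ?R"
  proof
    fix b assume "b \<in> insert a S"
    then show "b \<in> ?R"
    proof
      assume "b = a"
      then show ?thesis by (intro mem[OF S.zero_closed, of _ 1]) simp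
    next
      assume "b \<in> S"
      then have "b \<in> Idl\<^bsub>ring_R\<^esub> S" using genideal_self[of S] by auto
      then show ?thesis by (rule mem[of _ _ 0]) simp
    qed
  qed
  ultimately have "?L \<subseteq> ?R" by (rule genideal_minimal)
  moreover have "?R \<subseteq> ?L"
  proof
    fix b assume "b \<in> ?R"
    then obtain r s where b: "b = a * r + s" and s: "s \<in> Idl\<^bsub>ring_R\<^esub> S" by blast
    have sub: "insert a S \<subseteq> ?L" using genideal_self[of "insert a S"] by simp
    then have "S \<subseteq> ?L" by simp
    then have "Idl\<^bsub>ring_R\<^esub> S \<subseteq> ?L" by (intro genideal_minimal L.ideal_axioms)
    moreover have "a * r \<in> ?L" using L.I_r_closed[of a r] sub by simp
    ultimately show "b \<in> ?L" using L.a_closed[of "a * r" s] s b by auto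
  qed
  ultimately show ?thesis by blast
qed

lemma Idl_single: "Idl\<^bsub>ring_R\<^esub> {a} = {r. a dvd r}" for a :: "'k::field polyR"
  by (auto simp: Idl_insert Idl_empty dvd_def)

lemma Idl_pair: "Idl\<^bsub>ring_R\<^esub> {a, b} = {a * r + b * s |r s. True}" for a b :: "'k::field polyR"
  unfolding Idl_insert[of a] Idl_single dvd_def by blast

lemma R_t_power: "R_t ^ n = monom 1 n"
  by (simp add: R_t_def monom_altdef)

lemma const_power: "[:a:] ^ n = [:a ^ n:]" for a :: "'a::comm_semiring_1"
  by (induction n) (simp_all add: mult.commute)

lemma indet_var_nonzero: "indet_var i \<noteq> (0 :: 'k::field polyA)"
  unfolding indet_var_def by (metis lookup_single_eq lookup_zero zero_neq_one)

lemma f_poly_nonzero: "(f_poly :: 'k::field polyA) \<noteq> 0"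
proof -
  have ne: "single m 1 - single m' 1 \<noteq> (0 :: 'k polyA)" if "m \<noteq> m'" for m m'
  proof
    assume "single m 1 - single m' 1 = (0 :: 'k polyA)"
    then have "single m 1 = (single m' 1 :: 'k polyA)" by simp
    then have "lookup (single m 1) m = lookup (single m' 1 :: 'k polyA) m" by simp
    then show False using that by (simp add: lookup_single)
  qed
  have "single Ind_v 1 + single Ind_x 1 \<noteq> single Ind_u 1 + single Ind_y (1::nat)"
  proof
    assume "single Ind_v 1 + single Ind_x 1 = single Ind_u 1 + single Ind_y (1::nat)"
    then have "lookup (single Ind_v 1 + single Ind_x 1) Ind_v = lookup (single Ind_u 1 + single Ind_y (1::nat)) Ind_v"
      by (rule arg_cong)
    then show False by (simp add: lookup_add lookup_single)
  qed
  moreover have "single Ind_w 1 + single Ind_v 1 + single Ind_x 1 \<noteq> single Ind_z 1 + single Ind_u 1 + single Ind_y (1::nat)"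
  proof
    assume "single Ind_w 1 + single Ind_v 1 + single Ind_x 1 = single Ind_z 1 + single Ind_u 1 + single Ind_y (1::nat)"
    then have "lookup (single Ind_w 1 + single Ind_v 1 + single Ind_x 1) Ind_v =
        lookup (single Ind_z 1 + single Ind_u 1 + single Ind_y (1::nat)) Ind_v"
      by (rule arg_cong)
    then show False by (simp add: lookup_add lookup_single)
  qed
  ultimately show ?thesis
    unfolding f_poly_factored mult_eq_0_iff indet_var_def mult_single mult_1 using ne by blast
qed

lemma dehomogenize_diff: "dehomogenize (F - G) = dehomogenize F - dehomogenize G"
  by (simp add: dehomogenize_def)

lemma dehomogenize_f_poly: "dehomogenize (f_poly :: 'k::field polyA) = 0"
proof -
  have "dehomogenize (indet_var Ind_u) = (0 :: 'k poly poly)" "dehomogenize (indet_var Ind_v) = (0 :: 'k poly poly)"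
    by (simp_all add: dehomogenize_def indet_var_def dehomogenized_monomial_def)
  then have "dehomogenize (indet_var Ind_v * indet_var Ind_x - indet_var Ind_u * indet_var Ind_y) = (0 :: 'k poly poly)"
    by (simp add: dehomogenize_diff dehomogenize_mult)
  then show ?thesis unfolding f_poly_factored dehomogenize_mult by simp
qed

lemma regular_sequence_t_f: "regular_sequence (ring_R :: 'k::field polyR ring) [R_t, R_f]"
proof -
  have t: "R_t = monom 1 1" using R_t_power[of 1] by simp
  have "R_f * r \<in> Idl\<^bsub>ring_R\<^esub> {R_t} \<Longrightarrow> r \<in> Idl\<^bsub>ring_R\<^esub> {R_t}" for r :: "'k polyR"
    unfolding Idl_single t by (simp add: monom_1_dvd_iff' R_f_def f_poly_nonzero)
  moreover have "R_t * r \<in> Idl\<^bsub>ring_R\<^esub> {} \<Longrightarrow> r \<in> Idl\<^bsub>ring_R\<^esub> {}" for r :: "'k polyR"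
    by (simp add: Idl_empty R_t_def)
  moreover have "1 \<notin> Idl\<^bsub>ring_R\<^esub> {R_t, R_f :: 'k polyR}"
  proof
    assume "1 \<in> Idl\<^bsub>ring_R\<^esub> {R_t, R_f :: 'k polyR}"
    then obtain a b :: "'k polyR" where "1 = R_t * a + R_f * b" unfolding Idl_pair by blast
    then have "coeff 1 0 = coeff (R_t * a + R_f * b) 0" by simp
    then have "1 = f_poly * coeff b 0" by (simp add: R_t_def R_f_def)
    then have "dehomogenize 1 = dehomogenize (f_poly * coeff b 0)" by simp
    then show False by (simp add: dehomogenize_mult dehomogenize_f_poly)
  qed
  ultimately show ?thesis
    unfolding regular_sequence_def by (auto simp: less_Suc_eq)
qed

text \<open>Powers of \<open>t\<close> cut off the higher coefficients, and the remaining ones lie in \<open>A\<close>, so that regularity of \<open>y\<^sup>m\<close>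
  modulo \<open>(x\<^sup>m, t\<^sup>m)\<close> is a question about divisibility by a power of \<open>x\<close> in \<open>A\<close>.\<close>

lemma mem_Idl_x_t:
  "r \<in> Idl\<^bsub>ring_R\<^esub> {R_x ^ m, R_t ^ m} \<longleftrightarrow> (\<forall>i<m. indet_var Ind_x ^ m dvd coeff r i)" for r :: "'k::field polyR"
proof
  assume "r \<in> Idl\<^bsub>ring_R\<^esub> {R_x ^ m, R_t ^ m}"
  then obtain a b where "r = R_x ^ m * a + R_t ^ m * b" unfolding Idl_pair by blast
  then show "\<forall>i<m. indet_var Ind_x ^ m dvd coeff r i"
    by (simp add: R_t_power coeff_monom_mult R_x_def const_power)
next
  assume "\<forall>i<m. indet_var Ind_x ^ m dvd coeff r i"
  then obtain h where h: "\<And>i. i < m \<Longrightarrow> coeff r i = indet_var Ind_x ^ m * h i"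
    unfolding dvd_def by metis
  define a where "a = (\<Sum>i<m. monom (h i) i)"
  have "monom 1 m dvd r - R_x ^ m * a"
    unfolding monom_1_dvd_iff' using h by (simp add: a_def coeff_sum R_x_def const_power)
  then obtain b where "r - R_x ^ m * a = monom 1 m * b" by (auto elim: dvdE)
  then have "r = R_x ^ m * a + R_t ^ m * b" by (simp add: R_t_power algebra_simps)
  then show "r \<in> Idl\<^bsub>ring_R\<^esub> {R_x ^ m, R_t ^ m}" unfolding Idl_pair by blast
qed

lemma ideal_I_eq: "ideal_I = Idl\<^bsub>ring_R\<^esub> (set [R_y, R_x, R_t :: 'k::field polyR])"
proof -
  interpret cring "ring_R :: 'k polyR ring" by (rule cring_ring_R)
  let ?K = "Idl\<^bsub>ring_R\<^esub> (set [R_y, R_x, R_t :: 'k polyR])"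
  have self: "set [R_y, R_x, R_t :: 'k polyR] \<subseteq> ?K" by (rule genideal_self) simp
  interpret K: ideal ?K "ring_R :: 'k polyR ring" by (rule genideal_ideal) simp
  define u v w z :: "'k polyA"
    where "u = indet_var Ind_u" and "v = indet_var Ind_v" and "w = indet_var Ind_w" and "z = indet_var Ind_z"
  have f: "R_f = [:w * v ^ 2 * indet_var Ind_x - (w + z) * v * u * indet_var Ind_y:] * R_x +
    [:z * u ^ 2 * indet_var Ind_y:] * (R_y :: 'k polyR)"
    by (simp add: R_f_def R_x_def R_y_def f_poly_def Let_def u_def v_def w_def z_def algebra_simps power2_eq_square)
  have "R_f \<in> ?K"
  proof -
    have "c * a \<in> ?K" if "a \<in> ?K" for c a using K.I_l_closed[OF that, of c] by simp
    moreover have "a + b \<in> ?K" if "a \<in> ?K" "b \<in> ?K" for a b using K.a_closed[OF that] by simp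
    ultimately show ?thesis unfolding f using self by (metis insert_subset list.simps(15))
  qed
  then have "ideal_I \<subseteq> ?K"
    unfolding ideal_I_def using self by (intro genideal_minimal K.ideal_axioms) simp
  moreover have "?K \<subseteq> ideal_I"
  proof -
    have "{R_t, R_f, R_x, R_y} \<subseteq> (ideal_I :: 'k polyR set)" unfolding ideal_I_def by (rule genideal_self) simp
    moreover have "ideal ideal_I (ring_R :: 'k polyR ring)" unfolding ideal_I_def by (rule genideal_ideal) simp
    ultimately show ?thesis by (intro genideal_minimal) simp_all
  qed
  ultimately show ?thesis by blast
qed

section \<open>Infinitely many associated primes\<close>

text \<open>For irreducible \<open>p\<close> with homogenization \<open>P\<close> this is the ideal \<open>(t, u, v, x, y, P)\<close>. It is defined as the
  preimage of the ideal generated by \<open>p\<close> in \<open>K[T][S]\<close>, so that it is visibly prime.\<close>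

definition homogenized_prime :: "'k::field poly \<Rightarrow> 'k polyR set" where
  "homogenized_prime p = {r. [:p:] dvd dehomogenize (coeff r 0)}"

lemma primeideal_homogenized_prime:
  fixes p :: "'k::field poly"
  assumes "prime_elem p"
  shows "primeideal (homogenized_prime p) ring_R"
proof (rule primeidealI)
  have P: "prime_elem [:p:]" using assms by (simp add: prime_elem_const_poly_iff)
  have c0: "coeff (a * b) 0 = coeff a 0 * coeff b 0" for a b :: "'k polyR"
    by (simp add: coeff_mult)
  show "ideal (homogenized_prime p) ring_R"
    by (rule ideal_ring_RI) (auto simp: homogenized_prime_def dehomogenize_add c0 dehomogenize_mult)
  show "cring (ring_R :: 'k polyR ring)" by (rule cring_ring_R)
  have "1 \<notin> homogenized_prime p" using P by (auto simp: homogenized_prime_def)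
  then show "carrier ring_R \<noteq> homogenized_prime p" by auto
  show "a \<in> homogenized_prime p \<or> b \<in> homogenized_prime p" if "a \<otimes>\<^bsub>ring_R\<^esub> b \<in> homogenized_prime p" for a b
    using that P by (simp add: homogenized_prime_def c0 dehomogenize_mult prime_elem_dvd_mult_iff)
qed

text \<open>The form \<open>\<tau>\<close> of \<open>m\<close> lies in the ideal of \<open>p\<close> but, as \<open>p\<close> and \<open>p'\<close> divide polynomials without a common factor, not
  in the ideal of \<open>p'\<close>.\<close>

lemma homogenized_prime_separates:
  assumes "prime_elem p" "p dvd geometric_poly m" "p' dvd geometric_poly n" "coprime m n" "m > 0"
    "homogenized_prime p = homogenized_prime p'" "prime_elem p'"
  shows False
proof -
  obtain q where m: "m = Suc q" using assms(5) by (cases m) auto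
  let ?t = "[:homogenize q (geometric_poly m):]"
  have dehomogenize: "dehomogenize (coeff ?t 0) = monom (geometric_poly m) q"
    using dehomogenize_homogenize[OF degree_geometric_poly] by (simp add: m)
  have "?t \<in> homogenized_prime p"
    unfolding homogenized_prime_def mem_Collect_eq dehomogenize const_poly_dvd_iff using assms(2) by (auto simp: coeff_monom)
  then have "?t \<in> homogenized_prime p'" by (simp only: assms(6))
  then have "[:p':] dvd monom (geometric_poly m) q"
    by (simp only: homogenized_prime_def mem_Collect_eq dehomogenize)
  then have "p' dvd geometric_poly m" unfolding const_poly_dvd_iff by (metis coeff_monom)
  then have "p' dvd 1" using assms(3,4) by (rule not_dvd_coprime_geometric_polys[rotated])
  then show False using assms(7) by simp
qed

lemma ideal_J_mem: "j \<in> ideal_J \<longleftrightarrow> (\<exists>a b. j = R_t * a + R_f * b)" for j :: "'k::field polyR"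
  unfolding ideal_J_def Idl_pair by blast

text \<open>The connecting map from the cohomology of \<open>R/J = A/f\<close> to that of \<open>J\<close>, and its injectivity. In one direction compare
  the coefficients of \<open>t\<^bsup>k+n\<^esup>\<close>, using that elements of \<open>J\<close> have constant coefficient in \<open>(f)\<close>. In the other, the terms
  of \<open>r\<close> of positive degree in \<open>t\<close> contribute an element of \<open>t\<^bsup>k+n\<^esup> J\<close>, and \<open>t\<^bsup>k+n\<^esup>\<close> times anything is in \<open>J\<close>.\<close>

lemma J_multiples_iff:
  fixes r :: "'k::field polyR"
  assumes "n > 0"
  shows "(\<exists>j1\<in>ideal_J. \<exists>j2\<in>ideal_J. \<exists>j3\<in>ideal_J.
      (R_x * R_y * R_t) ^ k * (r * (R_t ^ n * [:g:])) = R_t ^ (k + n) * j1 + R_x ^ (k + n) * j2 + R_y ^ (k + n) * j3) \<longleftrightarrow>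
    (indet_var Ind_x * indet_var Ind_y) ^ k * (coeff r 0 * g) \<in>
      power_ideal f_poly (indet_var Ind_x) (indet_var Ind_y) (k + n)"
    (is "?lhs \<longleftrightarrow> ?c * (coeff r 0 * g) \<in> _")
proof -
  let ?N = "k + n"
  have L: "(R_x * R_y * R_t) ^ k * (r * (R_t ^ n * [:g:])) = R_t ^ ?N * ([:?c * g:] * r)"
  proof -
    have "(R_x * R_y) ^ k = [:?c:]" by (simp add: R_x_def R_y_def const_power mult.commute)
    then have "(R_x * R_y * R_t) ^ k = [:?c:] * R_t ^ k" by (simp only: power_mult_distrib)
    moreover have "[:?c * g:] = [:?c:] * [:g:]" by simp
    ultimately show ?thesis by (simp only: power_add mult_ac)
  qed
  show ?thesis
  proof
    assume ?lhs
    then obtain j1 j2 j3 where j: "j1 \<in> ideal_J"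
      and eq: "R_t ^ ?N * ([:?c * g:] * r) = R_t ^ ?N * j1 + R_x ^ ?N * j2 + R_y ^ ?N * j3" unfolding L by blast
    obtain a b where j1: "j1 = R_t * a + R_f * b" using j ideal_J_mem by blast
    have "coeff (R_t ^ ?N * ([:?c * g:] * r)) ?N = coeff (R_t ^ ?N * j1 + R_x ^ ?N * j2 + R_y ^ ?N * j3) ?N"
      by (simp only: eq)
    then have "?c * (coeff r 0 * g) = f_poly * coeff b 0 + indet_var Ind_x ^ ?N * coeff j2 ?N + indet_var Ind_y ^ ?N * coeff j3 ?N"
      by (simp add: R_t_power coeff_monom_mult R_x_def R_y_def const_power j1 R_f_def)
        (simp add: R_t_def mult_ac)
    then show "?c * (coeff r 0 * g) \<in> power_ideal f_poly (indet_var Ind_x) (indet_var Ind_y) ?N"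
      unfolding power_ideal_mem by blast
  next
    assume "?c * (coeff r 0 * g) \<in> power_ideal f_poly (indet_var Ind_x) (indet_var Ind_y) ?N"
    then obtain a b c where abc: "?c * (coeff r 0 * g) = f_poly * a + indet_var Ind_x ^ ?N * b + indet_var Ind_y ^ ?N * c"
      unfolding power_ideal_mem by blast
    obtain r' where r: "r = [:coeff r 0:] + R_t * r'"
      by (cases r) (auto simp: R_t_def)
    have "[:?c * g:] * r = [:?c * (coeff r 0 * g):] + R_t * ([:?c * g:] * r')"
    proof -
      have "[:?c * g:] * [:coeff r 0:] = [:?c * (coeff r 0 * g):]" by (simp add: mult_ac)
      moreover have "[:?c * g:] * r = [:?c * g:] * [:coeff r 0:] + R_t * ([:?c * g:] * r')"
        by (subst r) (simp only: distrib_left distrib_right mult_ac)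
      ultimately show ?thesis by simp
    qed
    also have "[:?c * (coeff r 0 * g):] = R_f * [:a:] + R_x ^ ?N * [:b:] + R_y ^ ?N * [:c:]"
      unfolding abc by (simp add: R_f_def R_x_def R_y_def const_power)
    finally have eq: "[:?c * g:] * r = R_f * [:a:] + R_x ^ ?N * [:b:] + R_y ^ ?N * [:c:] + R_t * ([:?c * g:] * r')" .
    have rearrange: "T * (F * a' + X' * b' + Y' * c' + t * s) = T * (t * s + F * a') + X' * (T * b') + Y' * (T * c')"
      for T F a' X' b' Y' c' t s :: "'k polyR" by (simp add: algebra_simps)
    have "R_t ^ ?N * ([:?c * g:] * r) = R_t ^ ?N * (R_t * ([:?c * g:] * r') + R_f * [:a:]) +
        R_x ^ ?N * (R_t ^ ?N * [:b:]) + R_y ^ ?N * (R_t ^ ?N * [:c:])"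
      unfolding eq by (rule rearrange)
    moreover have "R_t * ([:?c * g:] * r') + R_f * [:a:] \<in> ideal_J" unfolding ideal_J_mem by blast
    moreover have "R_t ^ ?N * s \<in> ideal_J" for s :: "'k polyR"
    proof -
      obtain M where "?N = Suc M" using assms by (cases ?N) auto
      then have "R_t ^ ?N * s = R_t * (R_t ^ M * s) + R_f * 0" by (simp add: mult.assoc)
      then show ?thesis unfolding ideal_J_mem by blast
    qed
    ultimately show ?lhs unfolding L by blast
  qed
qed

lemma homogenized_prime_in_Ass:
  fixes E :: "nat \<Rightarrow> ('k::field polyR, 'b) module" and p G :: "'k poly"
  assumes res: "injective_resolution ring_R (ideal_module ring_R ideal_J) E d \<epsilon>"
    and n: "n = Suc q" and pG: "p * G = geometric_poly n" and p: "prime_elem p"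
  shows "homogenized_prime p \<in> Ass ring_R (local_cohomology ring_R ideal_I E d 3)"
proof -
  interpret resolved_module "ring_R :: 'k polyR ring" "ideal_module ring_R ideal_J" E d \<epsilon>
    by unfold_locales (rule res)
  define g where "g = homogenize (q - degree p) G *
    (indet_var Ind_z ^ n * (indet_var Ind_v * indet_var Ind_x * (indet_var Ind_u * indet_var Ind_y) ^ q))"
  define rs where "rs = [R_y, R_x, R_t :: 'k polyR]"
  have len: "length rs = 3" by (simp add: rs_def)
  have t: "(R_t :: 'k polyR) \<noteq> 0" by (simp add: R_t_def)
  have "R_y ^ m * r \<in> Idl\<^bsub>ring_R\<^esub> {R_x ^ m, R_t ^ m} \<longrightarrow> r \<in> Idl\<^bsub>ring_R\<^esub> {R_x ^ m, R_t ^ m}"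
    for m and r :: "'k polyR"
    unfolding mem_Idl_x_t
    using indet_var_power_dvd_cancel[of Ind_x Ind_y] by (auto simp: R_y_def const_power)
  moreover have "R_x ^ m * r \<in> Idl\<^bsub>ring_R\<^esub> {R_t ^ m} \<longrightarrow> r \<in> Idl\<^bsub>ring_R\<^esub> {R_t ^ m}"
    for m and r :: "'k polyR"
    unfolding Idl_single R_t_power by (simp add: monom_1_dvd_iff' R_x_def const_power indet_var_nonzero)
  ultimately have reg: "regular_rev (map (\<lambda>a. a [^]\<^bsub>ring_R\<^esub> m) rs)" for m :: nat
    using t by (simp add: rs_def Idl_empty)
  have j: "R_t ^ n * [:g:] \<in> carrier (ideal_module ring_R ideal_J)"
  proof -
    have "R_t ^ n * [:g:] = R_t * (R_t ^ q * [:g:]) + R_f * 0" by (simp add: n mult.assoc)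
    then have "R_t ^ n * [:g:] \<in> ideal_J" unfolding ideal_J_mem by blast
    then show ?thesis by (simp add: ideal_module_def)
  qed
  have mult: "multiples (map (\<lambda>a. a [^]\<^bsub>ring_R\<^esub> m) rs) =
    {R_t ^ m * j1 + R_x ^ m * j2 + R_y ^ m * j3 |j1 j2 j3. j1 \<in> ideal_J \<and> j2 \<in> ideal_J \<and> j3 \<in> ideal_J}" for m :: nat
    unfolding rs_def list.map multiples.simps by (simp add: ideal_module_def) blast
  obtain C where C: "C \<in> carrier (local_cohomology ring_R (Idl\<^bsub>ring_R\<^esub> (set rs)) E d 3)"
    and ann: "annihilator ring_R (local_cohomology ring_R (Idl\<^bsub>ring_R\<^esub> (set rs)) E d 3) C =
      {r \<in> carrier ring_R. \<exists>k::nat. foldr (\<lambda>a b. a [^]\<^bsub>ring_R\<^esub> k \<otimes>\<^bsub>ring_R\<^esub> b) rs \<one>\<^bsub>ring_R\<^esub>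
        \<odot>\<^bsub>ideal_module ring_R ideal_J\<^esub> (r \<odot>\<^bsub>ideal_module ring_R ideal_J\<^esub> (R_t ^ n * [:g:])) \<in>
         multiples (map (\<lambda>a. a [^]\<^bsub>ring_R\<^esub> (k + n)) rs)}"
    using annihilator_of_represented_class[of rs 2 "R_t ^ n * [:g:]" n] reg j by (auto simp: len)
  have "annihilator ring_R (local_cohomology ring_R (Idl\<^bsub>ring_R\<^esub> (set rs)) E d 3) C = homogenized_prime p"
  proof -
    have fold: "foldr (\<lambda>a b. a [^]\<^bsub>ring_R\<^esub> k \<otimes>\<^bsub>ring_R\<^esub> b) rs \<one>\<^bsub>ring_R\<^esub> = (R_x * R_y * R_t) ^ k" for k :: nat
      by (simp add: rs_def power_mult_distrib mult_ac)
    have "(R_x * R_y * R_t) ^ k * (r * (R_t ^ n * [:g:])) \<in> multiples (map (\<lambda>a. a [^]\<^bsub>ring_R\<^esub> (k + n)) rs) \<longleftrightarrow>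
      (indet_var Ind_x * indet_var Ind_y) ^ k * (coeff r 0 * g) \<in>
        power_ideal f_poly (indet_var Ind_x) (indet_var Ind_y) (k + n)" for k r
    proof -
      have n0: "n > 0" using n by simp
      show ?thesis unfolding mult J_multiples_iff[OF n0, symmetric] by blast
    qed
    then show ?thesis
      unfolding ann fold homogenized_prime_def
      using annihilator_in_hypersurface[OF n pG p, folded g_def]
      by (simp add: ideal_module_def)
  qed
  then show ?thesis
    unfolding Ass_def ideal_I_eq using C primeideal_homogenized_prime[OF p] by (auto simp: rs_def)
qed

theorem mainTheorem2:
  shows "regular_sequence (ring_R :: 'k::field polyR ring) [R_t, R_f] \<and>
    (\<forall>(E :: nat \<Rightarrow> ('k polyR, 'b) module) d \<epsilon>.
      injective_resolution ring_R (ideal_module ring_R ideal_J) E d \<epsilon> \<longrightarrow>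
      infinite (Ass ring_R (local_cohomology ring_R ideal_I E d 3)))"
proof (intro conjI allI impI)
  show "regular_sequence (ring_R :: 'k polyR ring) [R_t, R_f]" by (rule regular_sequence_t_f)
  fix E :: "nat \<Rightarrow> ('k polyR, 'b) module" and d \<epsilon>
  assume res: "injective_resolution ring_R (ideal_module ring_R ideal_J) E d \<epsilon>"
  have "\<exists>p :: 'k poly. prime_elem p \<and> p dvd geometric_poly n" if "prime n" for n :: nat
  proof (rule exists_prime_factor)
    have "1 < n" using that by (rule prime_gt_1_nat)
    then have "coeff (geometric_poly n :: 'k poly) 1 \<noteq> 0" by (simp add: coeff_geometric_poly)
    then have "1 \<le> degree (geometric_poly n :: 'k poly)" by (rule le_degree)
    then show "degree (geometric_poly n :: 'k poly) > 0" by simp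
  qed
  then obtain p :: "nat \<Rightarrow> 'k poly" where p: "\<And>n. prime n \<Longrightarrow> prime_elem (p n) \<and> p n dvd geometric_poly n"
    by metis
  let ?P = "\<lambda>n. homogenized_prime (p n)"
  have "inj_on ?P {n. prime n}"
  proof (rule inj_onI, rule ccontr)
    fix m n assume mn: "m \<in> {n. prime n}" "n \<in> {n. prime n}" "?P m = ?P n" "m \<noteq> n"
    then have "coprime m n" by (simp add: primes_coprime)
    then show False
      using homogenized_prime_separates[of "p m" m "p n" n] mn p[of m] p[of n] prime_gt_0_nat[of m] by simp
  qed
  then have "infinite (?P ` {n. prime n})" using primes_infinite finite_imageD by blast
  moreover have "?P ` {n. prime n} \<subseteq> Ass ring_R (local_cohomology ring_R ideal_I E d 3)"
  proof clarify
    fix n :: nat assume "prime n"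
    then obtain q where "n = Suc q" using prime_gt_0_nat by (metis gr0_implies_Suc)
    moreover obtain G where "p n * G = geometric_poly n" using p[OF \<open>prime n\<close>] by (auto elim: dvdE)
    ultimately show "?P n \<in> Ass ring_R (local_cohomology ring_R ideal_I E d 3)"
      using homogenized_prime_in_Ass[OF res] p[OF \<open>prime n\<close>] by blast
  qed
  ultimately show "infinite (Ass ring_R (local_cohomology ring_R ideal_I E d 3))"
    using finite_subset by blast
qed

end
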